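(* Let $\mathcal{H}$ be a nonzero complex Hilbert space and let $A\in\mathcal{B}(\mathcal{H})$. If $f:[0,\infty)\to[0,\infty)$ is an increasing convex function, then \[f\left( w(A) \right)\le \frac{1}{2}\left\| f\left( \frac{3|A|+|A^{*}|}{4} \right)+f\left( \frac{|A|+3|A^{*}|}{4} \right) \right\|.\]
   Context: $\mathcal{B}(\mathcal{H})$ is the $C^*$-algebra of bounded linear operators on the complex Hilbert space $\mathcal{H}$; $\|\cdot\|$ is the operator norm; $w(A)=\sup_{\|x\|=1}|\langle Ax,x\rangle|$ is the numerical radius; $|A|=(A^*A)^{1/2}$ and $|A^*|=(AA^* )^{1/2}$. For a self adjoint operator $X$ with spectrum in the domain of $f$, $f(X)$ is defined by functional calculus. Convexity of $f$ is ordinary (scalar) convexity. *)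

theory Defs
  imports "HOL-Analysis.Analysis"
begin

(* The norm, distance and topology are those of real_normed_vector; they are tied to the
   complex inner product by norm_eq_sqrt_cinner.  The inner product is linear in its first
   argument and conjugate-linear in the second. *)
class complex_inner = real_normed_vector +
  fixes scaleC :: "complex \<Rightarrow> 'a \<Rightarrow> 'a"  (infixr "*\<^sub>C" 75)
    and cinner :: "'a \<Rightarrow> 'a \<Rightarrow> complex"
  assumes scaleR_scaleC: "r *\<^sub>R x = complex_of_real r *\<^sub>C x"
    and scaleC_add_right: "c *\<^sub>C (x + y) = c *\<^sub>C x + c *\<^sub>C y"
    and scaleC_add_left: "(c + d) *\<^sub>C x = c *\<^sub>C x + d *\<^sub>C x"
    and scaleC_scaleC: "c *\<^sub>C d *\<^sub>C x = (c * d) *\<^sub>C x"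
    and scaleC_one: "1 *\<^sub>C x = x"
    and cinner_commute: "cinner x y = cnj (cinner y x)"
    and cinner_add_left: "cinner (x + y) z = cinner x z + cinner y z"
    and cinner_scaleC_left: "cinner (c *\<^sub>C x) y = c * cinner x y"
    and cinner_ge_zero: "0 \<le> Re (cinner x x)"
    and cinner_eq_zero_iff: "cinner x x = 0 \<longleftrightarrow> x = 0"
    and norm_eq_sqrt_cinner: "norm x = sqrt (Re (cinner x x))"

class chilbert_space = complex_inner + complete_space

instantiation complex :: chilbert_space
begin

definition scaleC_complex :: "complex \<Rightarrow> complex \<Rightarrow> complex"
  where "scaleC_complex c x = c * x"

definition cinner_complex :: "complex \<Rightarrow> complex \<Rightarrow> complex"
  where "cinner_complex x y = x * cnj y"

instance
  by standard
    (auto simp: scaleC_complex_def cinner_complex_def scaleR_conv_of_real algebra_simps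
      cmod_def power2_eq_square)

end

(* The bounded linear functions of the library are only real-linear.  B(H) consists of those
   that are also complex-linear; norm on this type is the operator norm. *)
definition bounded_operators :: "('a::complex_inner \<Rightarrow>\<^sub>L 'a) set"
  where "bounded_operators = {A. \<forall>c x. blinfun_apply A (c *\<^sub>C x) = c *\<^sub>C blinfun_apply A x}"

definition adj :: "('a::chilbert_space \<Rightarrow>\<^sub>L 'a) \<Rightarrow> ('a \<Rightarrow>\<^sub>L 'a)"
  where "adj A =
    (THE B. \<forall>x y. cinner (blinfun_apply A x) y = cinner x (blinfun_apply B y))"

definition numerical_radius :: "('a::chilbert_space \<Rightarrow>\<^sub>L 'a) \<Rightarrow> real"
  where "numerical_radius A = (SUP x\<in>{x. norm x = 1}. cmod (cinner (blinfun_apply A x) x))"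

definition spectrum :: "('a::chilbert_space \<Rightarrow>\<^sub>L 'a) \<Rightarrow> complex set"
  where "spectrum A =
    {z. \<not> (\<exists>B\<in>bounded_operators. \<forall>x.
          blinfun_apply B (blinfun_apply A x - z *\<^sub>C x) = x \<and>
          blinfun_apply A (blinfun_apply B x) - z *\<^sub>C blinfun_apply B x = x)}"

definition op_power :: "('a::real_normed_vector \<Rightarrow>\<^sub>L 'a) \<Rightarrow> nat \<Rightarrow> ('a \<Rightarrow>\<^sub>L 'a)"
  where "op_power X n = ((\<lambda>T. X o\<^sub>L T) ^^ n) id_blinfun"

definition op_poly :: "real poly \<Rightarrow> ('a::real_normed_vector \<Rightarrow>\<^sub>L 'a) \<Rightarrow> ('a \<Rightarrow>\<^sub>L 'a)"
  where "op_poly p X = (\<Sum>i\<le>degree p. coeff p i *\<^sub>R op_power X i)"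

(* Continuous functional calculus f(X) of a self-adjoint X and a real function f continuous on
   the spectrum of X: the operator-norm limit of p_n(X), for real polynomials p_n converging to f
   uniformly on the spectrum.  The spectrum of a self-adjoint operator is real, so the set of
   real t below is the whole spectrum. *)
definition fun_calc :: "(real \<Rightarrow> real) \<Rightarrow> ('a::chilbert_space \<Rightarrow>\<^sub>L 'a) \<Rightarrow> ('a \<Rightarrow>\<^sub>L 'a)"
  where "fun_calc f X =
    (THE Y. \<exists>p. uniform_limit {t. complex_of_real t \<in> spectrum X} (\<lambda>n. poly (p n)) f sequentially \<and>
                (\<lambda>n. op_poly (p n) X) \<longlonglongrightarrow> Y)"

definition op_abs :: "('a::chilbert_space \<Rightarrow>\<^sub>L 'a) \<Rightarrow> ('a \<Rightarrow>\<^sub>L 'a)"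
  where "op_abs A = fun_calc sqrt (adj A o\<^sub>L A)"

end

theory Submission
  imports Defs "HOL-Computational_Algebra.Fundamental_Theorem_Algebra"
begin

text \<open>
  Write \<open>P = |A|\<close>, \<open>Q = |A\<^sup>*|\<close>, \<open>B = (3 P + Q) / 4\<close> and \<open>C = (P + 3 Q) / 4\<close>.  The mixed Schwarz
  inequality in additive form, \<open>2 |\<langle>A x, x\<rangle>| \<le> \<langle>P x, x\<rangle> + \<langle>Q x, x\<rangle>\<close> (\<open>mixed_schwarz\<close>), bounds
  \<open>|\<langle>A x, x\<rangle>|\<close> by the mean of \<open>\<langle>B x, x\<rangle>\<close> and \<open>\<langle>C x, x\<rangle>\<close>, because \<open>B + C = P + Q\<close>.  Monotonicity
  and convexity of \<open>f\<close> carry this over to the mean of \<open>f \<langle>B x, x\<rangle>\<close> and \<open>f \<langle>C x, x\<rangle>\<close>, and for unit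
  vectors Jensen's inequality \<open>f \<langle>X x, x\<rangle> \<le> \<langle>f(X) x, x\<rangle>\<close> (\<open>fun_calc_jensen\<close>) moves \<open>f\<close> inside the
  forms.  The result is at most half the norm of \<open>f(B) + f(C)\<close>; continuity of \<open>f\<close>
  (\<open>mono_convex_continuous_on\<close>) lets the supremum over \<open>x\<close> enter the argument of \<open>f\<close>.

  Most of the text builds the continuous functional calculus that gives \<open>|A|\<close> and \<open>f(X)\<close> a
  meaning.  Everything rests on one estimate: for self-adjoint \<open>X\<close> and a real polynomial \<open>p\<close> the
  norm of \<open>p(X)\<close> is attained by \<open>|p|\<close> on the spectrum (\<open>op_poly_norm_attained\<close>).  Its proof is
  algebraic.  With \<open>m\<close> the norm of \<open>p(X)\<close>, the operator \<open>p(X)\<^sup>2 - m\<^sup>2\<close> is not bounded below, so in the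
  real factorization of \<open>p\<^sup>2 - m\<^sup>2\<close> some linear factor \<open>X - t\<close> is not bounded below either; then
  \<open>t\<close> is a spectral value at which \<open>p\<^sup>2\<close> equals \<open>m\<^sup>2\<close>.  The estimate makes the calculus well defined and order
  preserving.

  Mixed Schwarz is proved without polar decomposition.  By \<open>A P = Q A\<close> and \<open>P\<^sup>2 = A\<^sup>* A\<close>,
  the case \<open>y = A u\<close> is the positivity of the form of \<open>P\<close> at \<open>x - P u\<close>; general vectors are reduced to it by
  a regularized projection onto the range of \<open>A\<close> (\<open>range_plus_almost_kernel\<close>).
\<close>

section \<open>The real inner product of a complex inner product space\<close>

lemma cinner_add_right: "cinner x (y + z) = cinner x y + cinner x z"
  by (metis cinner_add_left cinner_commute complex_cnj_add)

lemma cinner_scaleC_right: "cinner x (c *\<^sub>C y) = cnj c * cinner x y"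
  by (metis cinner_scaleC_left cinner_commute complex_cnj_mult)

definition rinner :: "'a::complex_inner \<Rightarrow> 'a \<Rightarrow> real"
  where "rinner x y = Re (cinner x y)"

lemma rinner_commute: "rinner x y = rinner y x"
  unfolding rinner_def by (subst cinner_commute) simp

lemma rinner_add_left: "rinner (x + y) z = rinner x z + rinner y z"
  by (simp add: rinner_def cinner_add_left)

lemma rinner_scaleR_left: "rinner (r *\<^sub>R x) y = r * rinner x y"
  by (simp add: rinner_def scaleR_scaleC cinner_scaleC_left)

lemma rinner_add_right: "rinner x (y + z) = rinner x y + rinner x z"
  by (metis rinner_add_left rinner_commute)

lemma rinner_scaleR_right: "rinner x (r *\<^sub>R y) = r * rinner x y"
  by (metis rinner_scaleR_left rinner_commute)

lemma rinner_self: "rinner x x = (norm x)\<^sup>2"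
  using cinner_ge_zero[of x] by (simp add: rinner_def norm_eq_sqrt_cinner)

lemma norm_add_square: "(norm (x + y))\<^sup>2 = (norm x)\<^sup>2 + 2 * rinner x y + (norm y)\<^sup>2"
  unfolding rinner_self[symmetric] rinner_add_left rinner_add_right
  by (simp add: rinner_commute)

text \<open>The norm of the class is a norm by assumption, so the Cauchy--Schwarz inequality is the
  triangle inequality, squared.\<close>

lemma rinner_le_norm: "rinner x y \<le> norm x * norm y"
proof -
  have "(norm (x + y))\<^sup>2 \<le> (norm x + norm y)\<^sup>2"
    by (simp add: norm_triangle_ineq)
  then show ?thesis
    by (simp add: norm_add_square power2_sum)
qed

lemma abs_rinner_le_norm: "\<bar>rinner x y\<bar> \<le> norm x * norm y"
  using rinner_le_norm[of x y] rinner_le_norm[of "(-1) *\<^sub>R x" y]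
  unfolding rinner_scaleR_left by simp

lemma bounded_bilinear_rinner: "bounded_bilinear rinner"
proof
  show "\<exists>K. \<forall>a b. norm (rinner a b) \<le> norm (a::'a) * norm b * K"
    using abs_rinner_le_norm by (intro exI[of _ 1]) auto
qed (simp_all add: rinner_add_left rinner_add_right rinner_scaleR_left rinner_scaleR_right)

lemmas rinner_simps =
  bounded_bilinear.add_left[OF bounded_bilinear_rinner]
  bounded_bilinear.add_right[OF bounded_bilinear_rinner]
  bounded_bilinear.diff_left[OF bounded_bilinear_rinner]
  bounded_bilinear.diff_right[OF bounded_bilinear_rinner]
  bounded_bilinear.minus_left[OF bounded_bilinear_rinner]
  bounded_bilinear.minus_right[OF bounded_bilinear_rinner]
  bounded_bilinear.zero_left[OF bounded_bilinear_rinner]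
  bounded_bilinear.zero_right[OF bounded_bilinear_rinner]
  rinner_scaleR_left rinner_scaleR_right

lemmas tendsto_rinner = bounded_bilinear.tendsto[OF bounded_bilinear_rinner]

lemma norm_diff_square: "(norm (x - y))\<^sup>2 = (norm x)\<^sup>2 - 2 * rinner x y + (norm y)\<^sup>2"
  using norm_add_square[of x "- y"] by (simp add: rinner_simps)

lemma rinner_eqI:
  assumes "\<And>z. rinner x z = rinner y z"
  shows "x = y"
proof -
  have "rinner (x - y) (x - y) = 0"
    by (simp only: rinner_simps assms)
  then show ?thesis
    by (simp add: rinner_self)
qed

lemma scaleC_scaleR: "c *\<^sub>C (r *\<^sub>R x) = r *\<^sub>R (c *\<^sub>C x)"
  by (simp add: scaleR_scaleC scaleC_scaleC mult.commute)

lemma Im_cinner: "Im (cinner x y) = - rinner (\<i> *\<^sub>C x) y"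
  by (simp add: rinner_def cinner_scaleC_left)

lemma norm_scaleC: "norm (c *\<^sub>C x) = cmod c * norm x"
proof -
  have "cinner (c *\<^sub>C x) (c *\<^sub>C x) = complex_of_real ((cmod c)\<^sup>2) * cinner x x"
    by (simp add: cinner_scaleC_left cinner_scaleC_right complex_norm_square mult.commute
        del: of_real_power)
  then have "(norm (c *\<^sub>C x))\<^sup>2 = (cmod c * norm x)\<^sup>2"
    unfolding power_mult_distrib rinner_self[symmetric] rinner_def by simp
  then show ?thesis
    by (simp add: power2_eq_iff_nonneg)
qed

text \<open>A unimodular scalar rotates an inner product onto the positive axis.  This is how estimates
  for the real part alone yield estimates for the modulus.\<close>

lemma cmod_cinner_eq_rinner:
  obtains c where "cmod c = 1" "cmod (cinner x y) = rinner (c *\<^sub>C x) y"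
proof -
  define z where "z = cinner x y"
  define c where "c = (if z = 0 then 1 else cnj z / cmod z)"
  have "c * z = cmod z"
    by (auto simp: c_def complex_norm_square[symmetric] power2_eq_square mult.commute[of "cnj z"])
  moreover have "cmod c = 1"
    by (simp add: c_def norm_divide)
  ultimately show thesis
    using that[of c] by (simp add: rinner_def cinner_scaleC_left z_def)
qed

lemma cmod_cinner_le_norm: "cmod (cinner x y) \<le> norm x * norm y"
proof -
  obtain c where "cmod c = 1" "cmod (cinner x y) = rinner (c *\<^sub>C x) y"
    by (rule cmod_cinner_eq_rinner)
  then show ?thesis
    using rinner_le_norm[of "c *\<^sub>C x" y] by (simp add: norm_scaleC)
qed

lemma bounded_bilinear_cinner: "bounded_bilinear cinner"
proof
  show "\<exists>K. \<forall>a b. norm (cinner a b) \<le> norm (a::'a) * norm b * K"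
    using cmod_cinner_le_norm by (intro exI[of _ 1]) auto
qed (simp_all add: cinner_add_left cinner_add_right scaleR_scaleC cinner_scaleC_left
  cinner_scaleC_right scaleR_conv_of_real scaleC_complex_def)

section \<open>Adjoints\<close>

text \<open>The Riesz representation, by the direct method: if \<open>\<psi>\<close> is represented by \<open>z\<close>, then \<open>z\<close>
  minimizes \<open>\<lambda>x. (norm x)\<^sup>2 - 2 * \<psi> x\<close>.  The parallelogram law makes every minimizing sequence a
  Cauchy sequence, and the first variation vanishes at the minimizer.\<close>

lemma riesz_representation_real:
  fixes \<psi> :: "'a::chilbert_space \<Rightarrow> real"
  assumes "bounded_linear \<psi>"
  obtains z where "\<And>x. \<psi> x = rinner x z"
proof -
  interpret \<psi>: bounded_linear \<psi> by fact
  define J where "J x = (norm x)\<^sup>2 - 2 * \<psi> x" for x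
  obtain K where K: "\<And>x. \<bar>\<psi> x\<bar> \<le> norm x * K"
    using \<psi>.bounded by auto
  have J_ge: "J x \<ge> - K\<^sup>2" for x
  proof -
    have "0 \<le> (norm x - K)\<^sup>2" by simp
    then show ?thesis
      using K[of x] unfolding J_def power2_diff by linarith
  qed
  define m where "m = Inf (range J)"
  have bdd: "bdd_below (range J)"
    using J_ge by (intro bdd_belowI) auto
  have m_le: "m \<le> J x" for x
    unfolding m_def by (intro cInf_lower bdd) auto
  have "\<exists>x. J x < m + inverse (Suc n)" for n
    using cInf_lessD[of "range J" "m + inverse (Suc n)"] unfolding m_def by auto
  then obtain X where X: "\<And>n. J (X n) < m + inverse (Suc n)" by metis
  have par: "(norm (x - y))\<^sup>2 = 2 * (J x + J y - 2 * J ((1/2) *\<^sub>R (x + y)))" for x y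
    by (simp add: J_def \<psi>.scaleR \<psi>.add norm_diff_square norm_add_square power_mult_distrib
      power_divide rinner_simps algebra_simps)
  have close: "(norm (X i - X j))\<^sup>2 \<le> 4 * inverse (Suc N)" if "i \<ge> N" "j \<ge> N" for i j N
  proof -
    have "inverse (real (Suc i)) \<le> inverse (Suc N)" "inverse (real (Suc j)) \<le> inverse (Suc N)"
      using that by (auto intro!: le_imp_inverse_le)
    then show ?thesis
      using X[of i] X[of j] m_le[of "(1/2) *\<^sub>R (X i + X j)"] unfolding par by argo
  qed
  have "Cauchy X"
  proof (rule metric_CauchyI)
    fix e :: real assume "e > 0"
    then obtain N where N: "inverse (real (Suc N)) < e\<^sup>2 / 4"
      using reals_Archimedean[of "e\<^sup>2 / 4"] by auto
    have "dist (X i) (X j) < e" if "i \<ge> N" "j \<ge> N" for i j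
    proof -
      have "(norm (X i - X j))\<^sup>2 < e\<^sup>2"
        using close[OF that] N by linarith
      then show ?thesis
        using \<open>e > 0\<close> by (simp add: dist_norm power2_less_imp_less)
    qed
    then show "\<exists>M. \<forall>m\<ge>M. \<forall>n\<ge>M. dist (X m) (X n) < e" by blast
  qed
  then obtain z where z: "X \<longlonglongrightarrow> z"
    by (auto simp: Cauchy_convergent_iff convergent_def)
  have "(\<lambda>n. J (X n)) \<longlonglongrightarrow> J z"
    unfolding J_def by (intro tendsto_intros \<psi>.tendsto z)
  moreover have "(\<lambda>n. m + inverse (real (Suc n))) \<longlonglongrightarrow> m + 0"
    by (intro tendsto_intros LIMSEQ_inverse_real_of_nat)
  ultimately have "J z \<le> m + 0"
    by (rule LIMSEQ_le) (use X less_imp_le in blast)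
  then have min: "J z \<le> J x" for x
    using m_le[of x] by linarith
  have "\<psi> h = rinner h z" for h
  proof -
    define d where "d = rinner h z - \<psi> h"
    have var: "0 \<le> 2 * s * d + s\<^sup>2 * (norm h)\<^sup>2" for s
      using min[of "z + s *\<^sub>R h"]
      by (simp add: J_def d_def norm_add_square \<psi>.add \<psi>.scaleR rinner_simps rinner_commute[of z]
        power_mult_distrib algebra_simps)
    define t where "t = 1 / ((norm h)\<^sup>2 + 1)"
    have t: "t > 0" "t * (norm h)\<^sup>2 \<le> 1"
      by (auto simp: t_def field_simps add_pos_nonneg intro: add_nonneg_pos)
    \<comment> \<open>for this small step the linear term dominates\<close>
    have "2 * (- t * d) * d + (- t * d)\<^sup>2 * (norm h)\<^sup>2 = - (t * d\<^sup>2) * (2 - t * (norm h)\<^sup>2)"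
      by (simp add: algebra_simps power2_eq_square)
    then have "0 \<le> - (t * d\<^sup>2) * (2 - t * (norm h)\<^sup>2)"
      using var[of "- t * d"] by simp
    moreover have "t * d\<^sup>2 * (2 - t * (norm h)\<^sup>2) \<ge> t * d\<^sup>2 * 1"
      using t by (intro mult_left_mono) auto
    ultimately have "t * d\<^sup>2 \<le> 0" by simp
    then have "d = 0"
      using t(1) by (simp add: mult_le_0_iff)
    then show ?thesis by (simp add: d_def)
  qed
  then show thesis by (rule that)
qed

lemma bounded_operators_scaleC:
  "A \<in> bounded_operators \<Longrightarrow> blinfun_apply A (c *\<^sub>C x) = c *\<^sub>C blinfun_apply A x"
  by (simp add: bounded_operators_def)

lemma adjoint_exists:
  fixes A :: "'a::chilbert_space \<Rightarrow>\<^sub>L 'a"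
  assumes "A \<in> bounded_operators"
  obtains B where "\<And>x y. cinner (blinfun_apply A x) y = cinner x (blinfun_apply B y)"
proof -
  have "\<exists>z. \<forall>x. rinner (blinfun_apply A x) y = rinner x z" for y
  proof -
    have "bounded_linear (\<lambda>x. rinner (blinfun_apply A x) y)"
      by (intro bounded_linear_compose[OF bounded_bilinear.bounded_linear_left
            [OF bounded_bilinear_rinner]] blinfun.bounded_linear_right)
    then show ?thesis by (metis riesz_representation_real)
  qed
  then obtain b where b: "\<And>x y. rinner (blinfun_apply A x) y = rinner x (b y)"
    by metis
  then have b': "rinner (b y) x = rinner y (blinfun_apply A x)" for x y
    by (metis rinner_commute)
  have "bounded_linear b"
  proof (rule bounded_linear_intro)
    show "b (x + y) = b x + b y" for x y
      by (rule rinner_eqI) (simp add: b' rinner_simps)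
    show "b (r *\<^sub>R x) = r *\<^sub>R b x" for r x
      by (rule rinner_eqI) (simp add: b' rinner_simps)
    show "norm (b y) \<le> norm y * norm A" for y
    proof (cases "b y = 0")
      case False
      have "norm (b y) * norm (b y) = rinner (b y) (b y)"
        by (simp add: rinner_self power2_eq_square)
      also have "\<dots> = rinner y (blinfun_apply A (b y))" by (rule b')
      also have "\<dots> \<le> norm y * (norm A * norm (b y))"
        by (rule order_trans[OF rinner_le_norm]) (simp add: mult_left_mono norm_blinfun)
      finally show ?thesis
        using False by (simp add: mult.assoc[symmetric])
    qed simp
  qed
  then have B: "blinfun_apply (Blinfun b) = b"
    by (simp add: bounded_linear_Blinfun_apply)
  show thesis
  proof (rule that[of "Blinfun b"])
    fix x y
    show "cinner (blinfun_apply A x) y = cinner x (blinfun_apply (Blinfun b) y)"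
    proof (rule complex_eqI)
      show "Re (cinner (blinfun_apply A x) y) = Re (cinner x (blinfun_apply (Blinfun b) y))"
        using b[of x y] by (simp add: rinner_def B)
      show "Im (cinner (blinfun_apply A x) y) = Im (cinner x (blinfun_apply (Blinfun b) y))"
        by (simp add: Im_cinner B b bounded_operators_scaleC[OF assms, symmetric])
    qed
  qed
qed

lemma cinner_adj:
  assumes "A \<in> bounded_operators"
  shows "cinner (blinfun_apply A x) y = cinner x (blinfun_apply (adj A) y)"
proof -
  obtain B where B: "\<forall>x y. cinner (blinfun_apply A x) y = cinner x (blinfun_apply B y)"
    using adjoint_exists[OF assms] by metis
  have "adj A = B"
    unfolding adj_def
  proof (rule the_equality)
    show "\<forall>x y. cinner (blinfun_apply A x) y = cinner x (blinfun_apply B y)" by (rule B)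
    fix C assume C: "\<forall>x y. cinner (blinfun_apply A x) y = cinner x (blinfun_apply C y)"
    show "C = B"
      by (intro blinfun_eqI rinner_eqI) (metis B C rinner_def rinner_commute)
  qed
  then show ?thesis using B by simp
qed

lemma rinner_adj:
  assumes "A \<in> bounded_operators"
  shows "rinner (blinfun_apply A x) y = rinner x (blinfun_apply (adj A) y)"
  using cinner_adj[OF assms] by (simp add: rinner_def)

lemma adj_bounded_operators:
  assumes "A \<in> bounded_operators"
  shows "adj A \<in> bounded_operators"
  unfolding bounded_operators_def
proof (intro CollectI allI)
  fix c x
  have "cinner z (blinfun_apply (adj A) (c *\<^sub>C x)) = cinner z (c *\<^sub>C blinfun_apply (adj A) x)" for z
    by (simp add: cinner_scaleC_right cinner_adj[OF assms, symmetric])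
  then show "blinfun_apply (adj A) (c *\<^sub>C x) = c *\<^sub>C blinfun_apply (adj A) x"
    by (intro rinner_eqI) (metis rinner_def rinner_commute)
qed

lemma adj_adj:
  assumes "A \<in> bounded_operators"
  shows "adj (adj A) = A"
  by (intro blinfun_eqI rinner_eqI)
    (metis adj_bounded_operators[OF assms] assms rinner_adj rinner_commute)

section \<open>Self-adjoint, positive and coercive operators\<close>

definition selfadjoint :: "('a::complex_inner \<Rightarrow>\<^sub>L 'a) \<Rightarrow> bool"
  where "selfadjoint X \<longleftrightarrow>
    (\<forall>x y. cinner (blinfun_apply X x) y = cinner x (blinfun_apply X y))"

definition positive_op :: "('a::complex_inner \<Rightarrow>\<^sub>L 'a) \<Rightarrow> bool"
  where "positive_op X \<longleftrightarrow> selfadjoint X \<and> (\<forall>x. 0 \<le> rinner (blinfun_apply X x) x)"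

definition bounded_below :: "('a::real_normed_vector \<Rightarrow>\<^sub>L 'a) \<Rightarrow> bool"
  where "bounded_below X \<longleftrightarrow> (\<exists>c>0. \<forall>x. c * norm x \<le> norm (blinfun_apply X x))"

lemma positive_op_selfadjoint: "positive_op X \<Longrightarrow> selfadjoint X"
  by (simp add: positive_op_def)

lemma selfadjoint_rinner:
  "selfadjoint X \<Longrightarrow> rinner (blinfun_apply X x) y = rinner x (blinfun_apply X y)"
  by (simp add: selfadjoint_def rinner_def)

lemma selfadjoint_norm_square:
  assumes "selfadjoint X"
  shows "(norm (blinfun_apply X x))\<^sup>2 = rinner (blinfun_apply X (blinfun_apply X x)) x"
  by (simp add: rinner_self[symmetric] selfadjoint_rinner[OF assms])

lemma selfadjoint_bounded_operators:
  assumes "selfadjoint X"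
  shows "X \<in> bounded_operators"
  unfolding bounded_operators_def
proof (intro CollectI allI)
  fix c x
  show "blinfun_apply X (c *\<^sub>C x) = c *\<^sub>C blinfun_apply X x"
    using assms unfolding selfadjoint_def
    by (intro rinner_eqI) (simp add: rinner_def cinner_scaleC_left)
qed

lemma selfadjoint_add: "selfadjoint X \<Longrightarrow> selfadjoint Y \<Longrightarrow> selfadjoint (X + Y)"
  by (simp add: selfadjoint_def blinfun.add_left cinner_add_left cinner_add_right)

lemma selfadjoint_scaleR: "selfadjoint X \<Longrightarrow> selfadjoint (r *\<^sub>R X)"
  by (simp add: selfadjoint_def blinfun.scaleR_left scaleR_scaleC cinner_scaleC_left
    cinner_scaleC_right)

lemma positive_op_add: "positive_op X \<Longrightarrow> positive_op Y \<Longrightarrow> positive_op (X + Y)"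
  by (simp add: positive_op_def selfadjoint_add blinfun.add_left rinner_simps)

lemma positive_op_scaleR: "positive_op X \<Longrightarrow> 0 \<le> r \<Longrightarrow> positive_op (r *\<^sub>R X)"
  by (simp add: positive_op_def selfadjoint_scaleR blinfun.scaleR_left rinner_simps)

lemma positive_op_adj_compose:
  assumes "A \<in> bounded_operators"
  shows "positive_op (adj A o\<^sub>L A)"
proof -
  have "selfadjoint (adj A o\<^sub>L A)"
    unfolding selfadjoint_def
    by (simp add: cinner_adj[OF assms, symmetric] cinner_adj[OF adj_bounded_operators[OF assms]]
      adj_adj[OF assms])
  moreover have "0 \<le> rinner (blinfun_apply (adj A o\<^sub>L A) x) x" for x
    by (simp add: rinner_adj[OF adj_bounded_operators[OF assms]] adj_adj[OF assms] rinner_self)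
  ultimately show ?thesis by (simp add: positive_op_def)
qed

text \<open>If \<open>T\<close> is coercive, then \<open>T x = y\<close> says that \<open>x\<close> is a fixed point of
  \<open>x \<mapsto> x - \<rho> (T x - y)\<close>, which is a contraction for a suitable \<open>\<rho> > 0\<close>; this yields the inverse.\<close>

lemma coercive_invertible:
  fixes T :: "'a::chilbert_space \<Rightarrow>\<^sub>L 'a"
  assumes T: "T \<in> bounded_operators"
    and "c > 0" and coercive: "\<And>x. c * (norm x)\<^sup>2 \<le> rinner (blinfun_apply T x) x"
  obtains B where "B \<in> bounded_operators"
    "\<And>x. blinfun_apply B (blinfun_apply T x) = x" "\<And>x. blinfun_apply T (blinfun_apply B x) = x"
proof -
  \<comment> \<open>adding \<open>c\<close> makes \<open>M\<close> positive and keeps the contraction factor real\<close>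
  define M where "M = norm T + c"
  have M: "M > 0" "c \<le> M" and MT: "norm (blinfun_apply T x) \<le> M * norm x" for x
  proof -
    show "M > 0" "c \<le> M" using \<open>c > 0\<close> by (simp_all add: M_def add_nonneg_pos)
    show "norm (blinfun_apply T x) \<le> M * norm x"
      unfolding M_def using \<open>c > 0\<close>
      by (intro order_trans[OF norm_blinfun] mult_right_mono) auto
  qed
  define \<rho> where "\<rho> = c / M\<^sup>2"
  define k where "k = sqrt (1 - c\<^sup>2 / M\<^sup>2)"
  have le1: "c\<^sup>2 / M\<^sup>2 \<le> 1"
    using M \<open>c > 0\<close> by (simp add: power_mono)
  have k: "0 \<le> k" "k < 1" "k\<^sup>2 = 1 - c\<^sup>2 / M\<^sup>2"
    using le1 M \<open>c > 0\<close> by (simp_all add: k_def)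
  have contr: "norm (x - \<rho> *\<^sub>R blinfun_apply T x) \<le> k * norm x" for x
  proof (rule power2_le_imp_le)
    have "(norm (x - \<rho> *\<^sub>R blinfun_apply T x))\<^sup>2
      = (norm x)\<^sup>2 - 2 * \<rho> * rinner (blinfun_apply T x) x + \<rho>\<^sup>2 * (norm (blinfun_apply T x))\<^sup>2"
      by (simp add: norm_diff_square rinner_simps rinner_commute[of x] power_mult_distrib)
    also have "\<dots> \<le> (norm x)\<^sup>2 - 2 * \<rho> * (c * (norm x)\<^sup>2) + \<rho>\<^sup>2 * (M * norm x)\<^sup>2"
      using M \<open>c > 0\<close> MT coercive
      by (intro add_mono diff_mono mult_left_mono power_mono) (auto simp: \<rho>_def)
    also have "\<dots> = (k * norm x)\<^sup>2"
      using M unfolding power_mult_distrib k(3) by (simp add: \<rho>_def field_simps power2_eq_square)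
    finally show "(norm (x - \<rho> *\<^sub>R blinfun_apply T x))\<^sup>2 \<le> (k * norm x)\<^sup>2" .
  qed (use k in auto)
  have ex: "\<exists>x. blinfun_apply T x = y" for y
  proof -
    define g where "g x = x - \<rho> *\<^sub>R (blinfun_apply T x - y)" for x
    have "dist (g x) (g x') \<le> k * dist x x'" for x x'
      using contr[of "x - x'"] by (simp add: g_def dist_norm blinfun.diff_right algebra_simps)
    then have "\<exists>!x. g x = x"
      using k by (intro banach_fix_type) auto
    then show ?thesis
      using M \<open>c > 0\<close> by (auto simp: g_def \<rho>_def)
  qed
  have lower: "c * norm x \<le> norm (blinfun_apply T x)" for x
  proof (cases "x = 0")
    case False
    have "c * norm x * norm x \<le> norm (blinfun_apply T x) * norm x"
      using coercive[of x] rinner_le_norm[of "blinfun_apply T x" x]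
      by (simp add: power2_eq_square mult.assoc)
    then show ?thesis using False by simp
  qed simp
  have inj: "x = x'" if "blinfun_apply T x = blinfun_apply T x'" for x x'
    using lower[of "x - x'"] that \<open>c > 0\<close> by (simp add: blinfun.diff_right mult_le_0_iff)
  obtain b where b: "\<And>y. blinfun_apply T (b y) = y" using ex by metis
  have "bounded_linear b"
  proof (rule bounded_linear_intro)
    show "b (x + y) = b x + b y" for x y
      by (rule inj) (simp add: b blinfun.add_right)
    show "b (r *\<^sub>R x) = r *\<^sub>R b x" for r x
      by (rule inj) (simp add: b blinfun.scaleR_right)
    show "norm (b y) \<le> norm y * (1 / c)" for y
      using lower[of "b y"] \<open>c > 0\<close> by (simp add: b field_simps)
  qed
  then have B: "blinfun_apply (Blinfun b) = b"
    by (simp add: bounded_linear_Blinfun_apply)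
  have "b (s *\<^sub>C x) = s *\<^sub>C b x" for s x
    by (rule inj) (simp add: b bounded_operators_scaleC[OF T])
  then show thesis
    using that[of "Blinfun b"] by (simp add: B b bounded_operators_def inj[OF b])
qed

section \<open>Polynomials in an operator\<close>

lemma op_poly_pCons:
  "blinfun_apply (op_poly (pCons a p) X) x =
    a *\<^sub>R x + blinfun_apply X (blinfun_apply (op_poly p X) x)"
proof -
  have extend: "op_poly q X = (\<Sum>i\<le>n. coeff q i *\<^sub>R op_power X i)" if "degree q \<le> n" for q n
    unfolding op_poly_def
    by (rule sum.mono_neutral_left) (use that in \<open>auto simp: coeff_eq_0\<close>)
  have "op_poly (pCons a p) X = (\<Sum>i\<le>Suc (degree p). coeff (pCons a p) i *\<^sub>R op_power X i)"
    by (rule extend) (rule degree_pCons_le)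
  also have "\<dots> = a *\<^sub>R op_power X 0 + (\<Sum>i\<le>degree p. coeff p i *\<^sub>R op_power X (Suc i))"
    by (simp only: sum.atMost_Suc_shift coeff_pCons_0 coeff_pCons_Suc)
  also have "blinfun_apply \<dots> x = a *\<^sub>R x + blinfun_apply X (blinfun_apply (op_poly p X) x)"
    by (simp add: op_power_def op_poly_def blinfun.add_left blinfun.scaleR_left
      blinfun.sum_left blinfun.sum_right blinfun.scaleR_right)
  finally show ?thesis .
qed

lemma op_poly_0: "op_poly 0 X = 0"
  by (simp add: op_poly_def)

lemma op_poly_const: "blinfun_apply (op_poly [:a:] X) x = a *\<^sub>R x"
  by (simp add: op_poly_pCons op_poly_0)

lemma op_poly_linear: "blinfun_apply (op_poly [:a, b:] X) x = a *\<^sub>R x + b *\<^sub>R blinfun_apply X x"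
  by (simp add: op_poly_pCons op_poly_const op_poly_0 blinfun.scaleR_right)

lemma op_poly_add: "op_poly (p + q) X = op_poly p X + op_poly q X"
proof (rule blinfun_eqI)
  show "blinfun_apply (op_poly (p + q) X) x = blinfun_apply (op_poly p X + op_poly q X) x" for x
    by (induction p q rule: poly_induct2)
      (simp_all add: op_poly_0 op_poly_pCons blinfun.add_left blinfun.add_right algebra_simps)
qed

lemma op_poly_smult: "op_poly (smult c p) X = c *\<^sub>R op_poly p X"
proof (rule blinfun_eqI)
  show "blinfun_apply (op_poly (smult c p) X) x = blinfun_apply (c *\<^sub>R op_poly p X) x" for x
    by (induction p)
      (simp_all add: op_poly_0 op_poly_pCons blinfun.scaleR_left blinfun.scaleR_right
        blinfun.add_right algebra_simps)
qed

lemma op_poly_diff: "op_poly (p - q) X = op_poly p X - op_poly q X"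
  using op_poly_add[of "p - q" q X] by (simp add: algebra_simps)

lemma op_poly_mult:
  "blinfun_apply (op_poly (p * q) X) x = blinfun_apply (op_poly p X) (blinfun_apply (op_poly q X) x)"
  by (induction p)
    (simp_all add: op_poly_0 op_poly_pCons op_poly_add op_poly_smult blinfun.add_left
      blinfun.scaleR_left mult_pCons_left)

lemma op_poly_intertwine:
  assumes "\<And>x. blinfun_apply C (blinfun_apply X x) = blinfun_apply Y (blinfun_apply C x)"
  shows "blinfun_apply C (blinfun_apply (op_poly p X) x)
    = blinfun_apply (op_poly p Y) (blinfun_apply C x)"
  by (induction p)
    (simp_all add: op_poly_0 op_poly_pCons blinfun.add_right blinfun.scaleR_right assms)

lemma selfadjoint_op_poly:
  assumes "selfadjoint X"
  shows "selfadjoint (op_poly p X)"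
proof -
  have "cinner (blinfun_apply (op_poly p X) x) y = cinner x (blinfun_apply (op_poly p X) y)" for x y
  proof (induction p arbitrary: x y)
    case 0
    then show ?case
      using cinner_add_left[of 0 0 y] cinner_add_right[of x 0 0] by (simp add: op_poly_0)
  next
    case (pCons a p)
    have "blinfun_apply X (blinfun_apply (op_poly p X) y)
      = blinfun_apply (op_poly p X) (blinfun_apply X y)"
      by (rule op_poly_intertwine) simp
    then show ?case
      using assms pCons.IH unfolding selfadjoint_def
      by (simp add: op_poly_pCons cinner_add_left cinner_add_right scaleR_scaleC
        cinner_scaleC_left cinner_scaleC_right)
  qed
  then show ?thesis by (simp add: selfadjoint_def)
qed

section \<open>The norm of a polynomial in a self-adjoint operator\<close>

abbreviation real_spectrum :: "('a::chilbert_space \<Rightarrow>\<^sub>L 'a) \<Rightarrow> real set"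
  where "real_spectrum X \<equiv> {t. complex_of_real t \<in> spectrum X}"

lemma bounded_below_comp:
  assumes "bounded_below X" "bounded_below Y"
    and Z: "\<And>x. blinfun_apply Z x = blinfun_apply X (blinfun_apply Y x)"
  shows "bounded_below Z"
proof -
  obtain c d where "c > 0" "d > 0" and c: "\<And>x. c * norm x \<le> norm (blinfun_apply X x)"
    and d: "\<And>x. d * norm x \<le> norm (blinfun_apply Y x)"
    using assms(1,2) unfolding bounded_below_def by metis
  have "c * d * norm x \<le> norm (blinfun_apply Z x)" for x
  proof -
    have "c * d * norm x \<le> c * norm (blinfun_apply Y x)"
      using d[of x] \<open>c > 0\<close> by (simp add: mult.assoc)
    also have "\<dots> \<le> norm (blinfun_apply Z x)" unfolding Z by (rule c)
    finally show ?thesis .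
  qed
  then show ?thesis
    unfolding bounded_below_def using \<open>c > 0\<close> \<open>d > 0\<close> by (intro exI[of _ "c * d"]) auto
qed

lemma not_bounded_below_in_real_spectrum:
  assumes "\<not> bounded_below (op_poly [:- t, 1:] X)"
  shows "t \<in> real_spectrum X"
proof (rule ccontr)
  assume "t \<notin> real_spectrum X"
  then obtain B where B: "\<And>x. blinfun_apply B (blinfun_apply X x - complex_of_real t *\<^sub>C x) = x"
    unfolding spectrum_def by auto
  have eq: "blinfun_apply (op_poly [:- t, 1:] X) x
    = blinfun_apply X x - complex_of_real t *\<^sub>C x" for x
    by (simp add: op_poly_linear scaleR_scaleC[symmetric])
  define K where "K = norm B + 1"
  have "K > 0" by (simp add: K_def add_nonneg_pos)
  have "norm x \<le> norm (blinfun_apply (op_poly [:- t, 1:] X) x) * K" for x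
  proof -
    have "norm x \<le> norm B * norm (blinfun_apply (op_poly [:- t, 1:] X) x)"
      using norm_blinfun[of B "blinfun_apply (op_poly [:- t, 1:] X) x"] by (simp add: eq B)
    also have "\<dots> \<le> norm (blinfun_apply (op_poly [:- t, 1:] X) x) * K"
      by (simp add: K_def algebra_simps)
    finally show ?thesis .
  qed
  then have "bounded_below (op_poly [:- t, 1:] X)"
    unfolding bounded_below_def using \<open>K > 0\<close>
    by (intro exI[of _ "1 / K"]) (simp add: field_simps)
  with assms show False ..
qed

lemma bounded_below_quadratic:
  assumes X: "selfadjoint X" and "b \<noteq> 0"
  shows "bounded_below (op_poly [:a\<^sup>2 + b\<^sup>2, - 2 * a, 1:] X)"
proof -
  let ?Q = "op_poly [:a\<^sup>2 + b\<^sup>2, - 2 * a, 1:] X"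
  have "b\<^sup>2 * norm x \<le> norm (blinfun_apply ?Q x)" for x
  proof (cases "x = 0")
    case False
    \<comment> \<open>the value at \<open>X\<close> is \<open>(X - a)\<^sup>2 + b\<^sup>2\<close>\<close>
    have "rinner (blinfun_apply ?Q x) x = (norm (blinfun_apply X x - a *\<^sub>R x))\<^sup>2 + b\<^sup>2 * (norm x)\<^sup>2"
      by (simp add: op_poly_pCons op_poly_0 norm_diff_square rinner_simps blinfun.add_right
        blinfun.diff_right blinfun.scaleR_right selfadjoint_norm_square[OF X] rinner_self algebra_simps
        power2_eq_square[of a] power_mult_distrib)
    then have "b\<^sup>2 * (norm x)\<^sup>2 \<le> norm (blinfun_apply ?Q x) * norm x"
      using rinner_le_norm[of "blinfun_apply ?Q x" x]
        zero_le_power2[of "norm (blinfun_apply X x - a *\<^sub>R x)"] by linarith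
    then show ?thesis
      using False by (simp add: power2_eq_square[of "norm x"] mult.assoc[symmetric])
  qed simp
  then show ?thesis
    unfolding bounded_below_def using \<open>b \<noteq> 0\<close> by (intro exI[of _ "b\<^sup>2"]) auto
qed

lemma poly_map_poly_of_real_add:
  "poly (map_poly complex_of_real (p + q)) z
    = poly (map_poly complex_of_real p) z + poly (map_poly complex_of_real q) z"
  by (induction p q rule: poly_induct2) (simp_all add: map_poly_pCons algebra_simps)

lemma poly_map_poly_of_real_smult:
  "poly (map_poly complex_of_real (smult c p)) z = c * poly (map_poly complex_of_real p) z"
  by (induction p) (simp_all add: map_poly_pCons algebra_simps)

lemma poly_map_poly_of_real_mult:
  "poly (map_poly complex_of_real (p * q)) z
    = poly (map_poly complex_of_real p) z * poly (map_poly complex_of_real q) z"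
  by (induction p)
    (simp_all add: map_poly_pCons poly_map_poly_of_real_add poly_map_poly_of_real_smult
      algebra_simps)

lemma poly_map_poly_of_real:
  "poly (map_poly complex_of_real p) (complex_of_real t) = complex_of_real (poly p t)"
  by (induction p) (simp_all add: map_poly_pCons)

lemma real_poly_factor:
  fixes p :: "real poly"
  assumes "degree p \<noteq> 0"
  obtains (linear) t q where "p = [:- t, 1:] * q"
  | (quadratic) a b q where "b \<noteq> 0" "p = [:a\<^sup>2 + b\<^sup>2, - 2 * a, 1:] * q"
proof -
  have "\<not> constant (poly (map_poly complex_of_real p))"
    using assms by (simp add: constant_degree degree_map_poly)
  then obtain z where z: "poly (map_poly complex_of_real p) z = 0"
    using fundamental_theorem_of_algebra by blast
  show thesis
  proof (cases "Im z = 0")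
    case True
    then have "z = complex_of_real (Re z)" by (simp add: complex_eq_iff)
    then have "poly p (Re z) = 0"
      using z poly_map_poly_of_real[of p "Re z"] by simp
    then show thesis
      using linear by (metis poly_eq_0_iff_dvd dvdE)
  next
    case False
    define m where "m = [:(Re z)\<^sup>2 + (Im z)\<^sup>2, - 2 * Re z, 1:]"
    have "poly (map_poly complex_of_real m) z = 0"
      by (simp add: m_def map_poly_pCons complex_eq_iff power2_eq_square algebra_simps)
    then have r0: "poly (map_poly complex_of_real (p mod m)) z = 0"
      using z poly_map_poly_of_real_add[of "p div m * m" "p mod m" z]
      by (simp add: poly_map_poly_of_real_mult)
    obtain u r where ur: "p mod m = pCons u r" by (rule pCons_cases)
    have "degree (p mod m) < 2"
      using degree_mod_less'[of m p] by (cases "p mod m = 0") (auto simp: m_def)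
    then have "degree r = 0"
      unfolding ur by (simp split: if_splits)
    then obtain v where uv: "p mod m = [:u, v:]"
      using ur by (metis degree_eq_zeroE)
    have "u + v * Re z = 0" "v * Im z = 0"
      using r0 by (simp_all add: uv map_poly_pCons complex_eq_iff mult.commute)
    then have "p mod m = 0" using False uv by simp
    then have "p = m * (p div m)"
      by (metis add.right_neutral div_mult_mod_eq mult.commute)
    then show thesis using quadratic False unfolding m_def by blast
  qed
qed

text \<open>Half of the spectral mapping theorem.  Over the reals a polynomial is a product of linear
  factors and of quadratic factors without real roots.  The latter are bounded below at a
  self-adjoint operator, so if the product is not bounded below, then one of its linear factors
  is not.\<close>

lemma not_bounded_below_op_poly_root:
  assumes X: "selfadjoint X" and "p \<noteq> 0" and "\<not> bounded_below (op_poly p X)"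
  obtains t where "t \<in> real_spectrum X" "poly p t = 0"
proof -
  have "\<exists>t\<in>real_spectrum X. poly p t = 0"
    using assms(2,3)
  proof (induction "degree p" arbitrary: p rule: less_induct)
    case less
    have deg: "degree q < degree p" if "p = m * q" "degree m > 0" for m q
      using that less.prems(1) by (auto simp: degree_mult_eq)
    have quot: "q \<noteq> 0" "\<not> bounded_below (op_poly q X)"
      if "p = m * q" "bounded_below (op_poly m X)" for m q
      using that less.prems bounded_below_comp[of "op_poly m X" "op_poly q X" "op_poly p X"]
      by (auto simp: op_poly_mult)
    show ?case
    proof (cases "degree p = 0")
      case True
      then obtain a where a: "p = [:a:]" by (metis degree_eq_zeroE)
      with less.prems have "bounded_below (op_poly p X)"
        unfolding bounded_below_def by (intro exI[of _ "\<bar>a\<bar>"]) (auto simp: op_poly_const)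
      with less.prems show ?thesis by blast
    next
      case False
      then show ?thesis
      proof (cases rule: real_poly_factor)
        case (linear t q)
        show ?thesis
        proof (cases "bounded_below (op_poly [:- t, 1:] X)")
          case True
          then have "\<exists>t\<in>real_spectrum X. poly q t = 0"
            by (intro less.hyps deg[OF linear] quot[OF linear]) auto
          then show ?thesis unfolding linear by auto
        next
          case False
          then have "t \<in> real_spectrum X" by (rule not_bounded_below_in_real_spectrum)
          then show ?thesis unfolding linear by (intro bexI[of _ t]) auto
        qed
      next
        case (quadratic a b q)
        have "\<exists>t\<in>real_spectrum X. poly q t = 0"
          by (intro less.hyps deg[OF quadratic(2)] quot[OF quadratic(2)] bounded_below_quadratic X quadratic(1)) auto
        then show ?thesis unfolding quadratic(2) by auto
      qed
    qed
  qed
  then show thesis using that by blast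
qed

text \<open>For a self-adjoint \<open>Q\<close> with \<open>m = norm Q\<close>, the identity
  \<open>(norm (Q (Q x) - m\<^sup>2 x))\<^sup>2 = (norm (Q (Q x)))\<^sup>2 - 2 m\<^sup>2 (norm (Q x))\<^sup>2 + m\<^sup>4 (norm x)\<^sup>2\<close> shows that
  vectors that almost attain the norm of \<open>Q\<close> are almost annihilated by \<open>Q\<^sup>2 - m\<^sup>2\<close>.\<close>

lemma selfadjoint_norm_not_bounded_below:
  fixes Q :: "'a::complex_inner \<Rightarrow>\<^sub>L 'a"
  assumes nontrivial: "\<exists>x::'a. x \<noteq> 0" and Q: "selfadjoint Q"
    and R: "\<And>x. blinfun_apply R x = blinfun_apply Q (blinfun_apply Q x) - (norm Q)\<^sup>2 *\<^sub>R x"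
  shows "\<not> bounded_below R"
proof
  assume "bounded_below R"
  then obtain c where "c > 0" and c: "\<And>x. c * norm x \<le> norm (blinfun_apply R x)"
    unfolding bounded_below_def by blast
  obtain z :: 'a where "z \<noteq> 0" using nontrivial by blast
  define m where "m = norm Q"
  have est: "c\<^sup>2 * (norm x)\<^sup>2 \<le> m\<^sup>2 * (m\<^sup>2 * (norm x)\<^sup>2 - (norm (blinfun_apply Q x))\<^sup>2)" for x
  proof -
    have "c\<^sup>2 * (norm x)\<^sup>2 \<le> (norm (blinfun_apply R x))\<^sup>2"
      using power_mono[OF c, of x 2] \<open>c > 0\<close> by (simp add: power_mult_distrib)
    also have "\<dots> = (norm (blinfun_apply Q (blinfun_apply Q x)))\<^sup>2
        - 2 * m\<^sup>2 * (norm (blinfun_apply Q x))\<^sup>2 + m\<^sup>2 * m\<^sup>2 * (norm x)\<^sup>2"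
      by (simp add: R norm_diff_square rinner_simps selfadjoint_norm_square[OF Q, of x]
        power_mult_distrib m_def power2_eq_square[of "(norm Q)\<^sup>2"])
    also have "(norm (blinfun_apply Q (blinfun_apply Q x)))\<^sup>2 \<le> m\<^sup>2 * (norm (blinfun_apply Q x))\<^sup>2"
      using power_mono[OF norm_blinfun[of Q "blinfun_apply Q x"], of 2]
      by (simp add: m_def power_mult_distrib)
    finally show ?thesis by (simp add: algebra_simps)
  qed
  have "c\<^sup>2 * (norm z)\<^sup>2 > 0" using \<open>c > 0\<close> \<open>z \<noteq> 0\<close> by simp
  then have "m \<noteq> 0" using est[of z] by auto
  then have "m > 0" by (simp add: m_def)
  have est': "(norm (blinfun_apply Q x))\<^sup>2 \<le> (m\<^sup>2 - c\<^sup>2 / m\<^sup>2) * (norm x)\<^sup>2" for x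
    using est[of x] \<open>m > 0\<close> by (simp add: field_simps)
  have nonneg: "0 \<le> m\<^sup>2 - c\<^sup>2 / m\<^sup>2"
    using order_trans[OF zero_le_power2 est'[of z]] \<open>z \<noteq> 0\<close> by (simp add: zero_le_mult_iff)
  define k where "k = sqrt (m\<^sup>2 - c\<^sup>2 / m\<^sup>2)"
  have k: "k \<ge> 0" "k\<^sup>2 = m\<^sup>2 - c\<^sup>2 / m\<^sup>2" using nonneg by (simp_all add: k_def)
  have "norm (blinfun_apply Q x) \<le> k * norm x" for x
  proof (rule power2_le_imp_le)
    show "(norm (blinfun_apply Q x))\<^sup>2 \<le> (k * norm x)\<^sup>2"
      unfolding power_mult_distrib k(2) by (rule est')
    show "0 \<le> k * norm x" by (intro mult_nonneg_nonneg k(1) norm_ge_zero)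
  qed
  then have "m \<le> k"
    unfolding m_def using k by (intro norm_blinfun_bound) auto
  then have "m\<^sup>2 \<le> k\<^sup>2" using \<open>m > 0\<close> by (intro power_mono) auto
  moreover have "c\<^sup>2 / m\<^sup>2 > 0" using \<open>c > 0\<close> \<open>m > 0\<close> by simp
  ultimately show False unfolding k(2) by linarith
qed

text \<open>Apply the two preceding results to \<open>p\<^sup>2 - m\<^sup>2\<close> with \<open>m = norm (op_poly p X)\<close>: a root of this
  polynomial is a point where \<open>\<bar>p\<bar>\<close> takes the value \<open>m\<close>.\<close>

theorem op_poly_norm_attained:
  fixes X :: "'a::chilbert_space \<Rightarrow>\<^sub>L 'a"
  assumes nontrivial: "\<exists>x::'a. x \<noteq> 0" and X: "selfadjoint X"
  obtains t where "t \<in> real_spectrum X" "\<bar>poly p t\<bar> = norm (op_poly p X)"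
proof -
  let ?r = "\<lambda>q. q * q - [:(norm (op_poly q X))\<^sup>2:]"
  have nbb: "\<not> bounded_below (op_poly (?r q) X)" for q
    by (rule selfadjoint_norm_not_bounded_below[OF nontrivial selfadjoint_op_poly[OF X, of q]])
      (simp add: op_poly_diff op_poly_mult op_poly_const blinfun.diff_left)
  have attained: "\<exists>t\<in>real_spectrum X. \<bar>poly q t\<bar> = norm (op_poly q X)" if nz: "?r q \<noteq> 0" for q
  proof -
    obtain t where t: "t \<in> real_spectrum X" "poly (?r q) t = 0"
      using not_bounded_below_op_poly_root[OF X nz nbb] by blast
    then have "(poly q t)\<^sup>2 = (norm (op_poly q X))\<^sup>2"
      by (simp add: power2_eq_square)
    then have "\<bar>poly q t\<bar> = norm (op_poly q X)"
      by (metis abs_norm_cancel power2_eq_iff abs_minus_cancel)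
    with t show ?thesis by blast
  qed
  show thesis
  proof (cases "?r p = 0")
    case False
    then show thesis using attained that by blast
  next
    case True
    \<comment> \<open>then \<open>p\<close> is constant, and it suffices that the spectrum contains some real number\<close>
    have "?r [:0, 1:] \<noteq> 0" by simp
    then obtain t where t: "t \<in> real_spectrum X" using attained by blast
    have "poly (?r p) t = 0" unfolding True by simp
    then have "(poly p t)\<^sup>2 = (norm (op_poly p X))\<^sup>2"
      by (simp add: power2_eq_square)
    then have "\<bar>poly p t\<bar> = norm (op_poly p X)"
      by (metis abs_norm_cancel power2_eq_iff abs_minus_cancel)
    with t show thesis using that by blast
  qed
qed

lemma norm_op_poly_le:
  fixes X :: "'a::chilbert_space \<Rightarrow>\<^sub>L 'a"
  assumes "\<exists>x::'a. x \<noteq> 0" "selfadjoint X" "\<And>t. t \<in> real_spectrum X \<Longrightarrow> \<bar>poly p t\<bar> \<le> e"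
  shows "norm (op_poly p X) \<le> e"
  using op_poly_norm_attained[OF assms(1,2)] assms(3) by metis

text \<open>\<open>X - t\<close> is coercive for \<open>t < 0\<close>, and \<open>t - X\<close> is coercive for \<open>t > norm X\<close>.\<close>

lemma positive_op_real_spectrum:
  assumes X: "positive_op X"
  shows "real_spectrum X \<subseteq> {0..norm X}"
proof
  fix t assume t: "t \<in> real_spectrum X"
  note sX = positive_op_selfadjoint[OF X]
  have not_inv: False if B: "B \<in> bounded_operators"
    "\<And>x. blinfun_apply B (blinfun_apply X x - t *\<^sub>R x) = x"
    "\<And>x. blinfun_apply X (blinfun_apply B x) - t *\<^sub>R blinfun_apply B x = x" for B
    using t that unfolding spectrum_def by (auto simp: scaleR_scaleC)
  have "\<not> t < 0"
  proof
    assume "t < 0"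
    have "op_poly [:- t, 1:] X \<in> bounded_operators"
      by (intro selfadjoint_bounded_operators selfadjoint_op_poly sX)
    moreover have "- t * (norm x)\<^sup>2 \<le> rinner (blinfun_apply (op_poly [:- t, 1:] X) x) x" for x
      using X by (simp add: positive_op_def op_poly_linear rinner_simps rinner_self)
    ultimately obtain B where "B \<in> bounded_operators"
      "\<And>x. blinfun_apply B (blinfun_apply (op_poly [:- t, 1:] X) x) = x"
      "\<And>x. blinfun_apply (op_poly [:- t, 1:] X) (blinfun_apply B x) = x"
      using coercive_invertible[of "op_poly [:- t, 1:] X" "- t"] \<open>t < 0\<close> by auto
    then show False
      by (intro not_inv[of B]) (simp_all add: op_poly_linear)
  qed
  moreover have "\<not> norm X < t"
  proof
    assume "norm X < t"
    have "op_poly [:t, - 1:] X \<in> bounded_operators"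
      by (intro selfadjoint_bounded_operators selfadjoint_op_poly sX)
    moreover have "(t - norm X) * (norm x)\<^sup>2 \<le> rinner (blinfun_apply (op_poly [:t, - 1:] X) x) x"
      for x
    proof -
      have "rinner (blinfun_apply X x) x \<le> norm X * norm x * norm x"
        by (rule order_trans[OF rinner_le_norm]) (simp add: mult_right_mono norm_blinfun)
      then show ?thesis
        by (simp add: op_poly_linear rinner_simps rinner_self power2_eq_square algebra_simps)
    qed
    ultimately obtain B where B: "B \<in> bounded_operators"
      "\<And>x. blinfun_apply B (blinfun_apply (op_poly [:t, - 1:] X) x) = x"
      "\<And>x. blinfun_apply (op_poly [:t, - 1:] X) (blinfun_apply B x) = x"
      using coercive_invertible[of "op_poly [:t, - 1:] X" "t - norm X"] \<open>norm X < t\<close> by auto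
    have neg: "blinfun_apply X x - t *\<^sub>R x = - blinfun_apply (op_poly [:t, - 1:] X) x" for x
      by (simp add: op_poly_linear)
    have "- B \<in> bounded_operators"
      using B(1) scaleC_scaleR[of _ "-1" "blinfun_apply B _"]
      by (simp add: bounded_operators_def blinfun.minus_left)
    then show False
    proof (rule not_inv)
      show "blinfun_apply (- B) (blinfun_apply X x - t *\<^sub>R x) = x" for x
        by (simp add: neg B blinfun.minus_left blinfun.minus_right)
      show "blinfun_apply X (blinfun_apply (- B) x) - t *\<^sub>R blinfun_apply (- B) x = x" for x
        using B(3)[of x] by (simp add: op_poly_linear blinfun.minus_left blinfun.minus_right)
    qed
  qed
  ultimately show "t \<in> {0..norm X}" by auto
qed

text \<open>The norm bound turns into a bound for the form when \<open>p\<close> is recentred by a constant \<open>s\<close>: if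
  \<open>\<bar>p - s\<bar> \<le> s - c\<close> on the spectrum, then \<open>\<langle>p(X) x, x\<rangle> \<ge> (s - (s - c)) (norm x)\<^sup>2\<close>.\<close>

lemma op_poly_lower_bound:
  fixes X :: "'a::chilbert_space \<Rightarrow>\<^sub>L 'a"
  assumes nontrivial: "\<exists>x::'a. x \<noteq> 0" and X: "positive_op X"
    and lower: "\<And>t. t \<in> real_spectrum X \<Longrightarrow> c \<le> poly p t"
  shows "c * (norm x)\<^sup>2 \<le> rinner (blinfun_apply (op_poly p X) x) x"
proof -
  have "compact (poly p ` {0..norm X})"
    by (intro compact_continuous_image continuous_intros compact_Icc)
  then obtain M where "\<forall>t\<in>{0..norm X}. \<bar>poly p t\<bar> \<le> M"
    by (auto dest!: compact_imp_bounded simp: bounded_iff)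
  then have M: "\<bar>poly p t\<bar> \<le> M" if "t \<in> {0..norm X}" for t
    using that by blast
  \<comment> \<open>the distance of \<open>p\<close> on the spectrum from the midpoint \<open>s\<close> of \<open>c\<close> and \<open>M\<close> is at most \<open>s - c\<close>\<close>
  define s where "s = (M + c) / 2"
  have "norm (op_poly (p - [:s:]) X) \<le> s - c"
  proof (rule norm_op_poly_le[OF nontrivial positive_op_selfadjoint[OF X]])
    fix t assume t: "t \<in> real_spectrum X"
    then have "t \<in> {0..norm X}" using positive_op_real_spectrum[OF X] by blast
    then show "\<bar>poly (p - [:s:]) t\<bar> \<le> s - c"
      using M[of t] lower[OF t] by (auto simp: s_def field_simps abs_le_iff)
  qed
  then have "norm (blinfun_apply (op_poly (p - [:s:]) X) x) * norm x \<le> (s - c) * norm x * norm x"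
    by (intro mult_right_mono order_trans[OF norm_blinfun]) auto
  moreover have "\<bar>rinner (blinfun_apply (op_poly (p - [:s:]) X) x) x\<bar>
      \<le> norm (blinfun_apply (op_poly (p - [:s:]) X) x) * norm x"
    by (rule abs_rinner_le_norm)
  moreover have "rinner (blinfun_apply (op_poly (p - [:s:]) X) x) x
      = rinner (blinfun_apply (op_poly p X) x) x - s * (norm x)\<^sup>2"
    by (simp add: op_poly_diff op_poly_const blinfun.diff_left rinner_simps rinner_self)
  ultimately show ?thesis
    by (simp add: power2_eq_square algebra_simps)
qed

section \<open>Continuous functional calculus\<close>

instance chilbert_space \<subseteq> banach ..

text \<open>Any sequence of polynomials that approximates \<open>f\<close> uniformly on the spectrum computes
  \<open>f(X)\<close>: the norm of \<open>p(X)\<close> is controlled by the values of \<open>p\<close> on the spectrum, so the values at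
  \<open>X\<close> form a Cauchy sequence whose limit does not depend on the approximation.\<close>

lemma fun_calc_tendsto:
  fixes X :: "'a::chilbert_space \<Rightarrow>\<^sub>L 'a"
  assumes nontrivial: "\<exists>x::'a. x \<noteq> 0" and X: "selfadjoint X"
    and p: "uniform_limit (real_spectrum X) (\<lambda>n. poly (p n)) f sequentially"
  shows "(\<lambda>n. op_poly (p n) X) \<longlonglongrightarrow> fun_calc f X"
proof -
  have close: "norm (op_poly (q n) X - op_poly (r k) X) < e"
    if q: "\<forall>t\<in>real_spectrum X. dist (poly (q n) t) (f t) < e / 3"
    and r: "\<forall>t\<in>real_spectrum X. dist (poly (r k) t) (f t) < e / 3" and "e > 0" for q r n k e
  proof -
    have "norm (op_poly (q n - r k) X) \<le> 2 * (e / 3)"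
    proof (rule norm_op_poly_le[OF nontrivial X])
      fix t assume t: "t \<in> real_spectrum X"
      then show "\<bar>poly (q n - r k) t\<bar> \<le> 2 * (e / 3)"
        using bspec[OF q t] bspec[OF r t] unfolding dist_real_def poly_diff by linarith
    qed
    then show ?thesis using \<open>e > 0\<close> by (simp add: op_poly_diff)
  qed
  have ev: "\<forall>\<^sub>F n in sequentially. \<forall>t\<in>real_spectrum X. dist (poly (q n) t) (f t) < e / 3"
    if "uniform_limit (real_spectrum X) (\<lambda>n. poly (q n)) f sequentially" "e > 0" for q e
    using uniform_limitD[OF that(1), of "e / 3"] that(2) by simp
  have "Cauchy (\<lambda>n. op_poly (p n) X)"
  proof (rule metric_CauchyI)
    fix e :: real assume "e > 0"
    then obtain N where N: "\<And>n. n \<ge> N \<Longrightarrow> \<forall>t\<in>real_spectrum X. dist (poly (p n) t) (f t) < e / 3"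
      using ev[OF p] unfolding eventually_sequentially by meson
    then show "\<exists>M. \<forall>m\<ge>M. \<forall>n\<ge>M. dist (op_poly (p m) X) (op_poly (p n) X) < e"
      using close[of p _ e p] \<open>e > 0\<close> unfolding dist_norm by meson
  qed
  then obtain Y where Y: "(\<lambda>n. op_poly (p n) X) \<longlonglongrightarrow> Y"
    by (auto simp: Cauchy_convergent_iff convergent_def)
  have "fun_calc f X = Y"
    unfolding fun_calc_def
  proof (rule the_equality)
    show "\<exists>p. uniform_limit (real_spectrum X) (\<lambda>n. poly (p n)) f sequentially \<and>
        (\<lambda>n. op_poly (p n) X) \<longlonglongrightarrow> Y"
      using p Y by blast
    fix Z
    assume "\<exists>p. uniform_limit (real_spectrum X) (\<lambda>n. poly (p n)) f sequentially \<and>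
        (\<lambda>n. op_poly (p n) X) \<longlonglongrightarrow> Z"
    then obtain q where q: "uniform_limit (real_spectrum X) (\<lambda>n. poly (q n)) f sequentially"
      "(\<lambda>n. op_poly (q n) X) \<longlonglongrightarrow> Z"
      by blast
    have "(\<lambda>n. op_poly (q n) X - op_poly (p n) X) \<longlonglongrightarrow> 0"
    proof (rule tendstoI)
      fix e :: real assume "e > 0"
      show "\<forall>\<^sub>F n in sequentially. dist (op_poly (q n) X - op_poly (p n) X) 0 < e"
        using ev[OF q(1) \<open>e > 0\<close>] ev[OF p \<open>e > 0\<close>]
        by eventually_elim (simp add: close[OF _ _ \<open>e > 0\<close>])
    qed
    moreover have "(\<lambda>n. op_poly (q n) X - op_poly (p n) X) \<longlonglongrightarrow> Z - Y"
      by (intro tendsto_diff q Y)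
    ultimately have "Z - Y = 0" using LIMSEQ_unique by blast
    then show "Z = Y" by simp
  qed
  then show ?thesis using Y by simp
qed

lemma uniform_limit_polynomials:
  fixes f :: "real \<Rightarrow> real"
  assumes "continuous_on {a..b} f"
  obtains p where "uniform_limit {a..b} (\<lambda>n. poly (p n)) f sequentially"
proof -
  have "\<exists>p. \<forall>t\<in>{a..b}. \<bar>f t - poly p t\<bar> < inverse (Suc n)" for n
  proof -
    obtain g where g: "real_polynomial_function g"
      "\<And>t. t \<in> {a..b} \<Longrightarrow> \<bar>f t - g t\<bar> < inverse (Suc n)"
      using Stone_Weierstrass_real_polynomial_function[OF compact_Icc assms, of "inverse (Suc n)"]
      by auto
    obtain c k where "g = (\<lambda>t. \<Sum>i\<le>k. c i * t ^ i)"
      using g(1) unfolding real_polynomial_function_iff_sum by blast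
    then have "g = poly (\<Sum>i\<le>k. monom (c i) i)"
      by (auto simp: poly_sum poly_monom)
    with g(2) show ?thesis by blast
  qed
  then obtain p where p: "\<And>n t. t \<in> {a..b} \<Longrightarrow> \<bar>f t - poly (p n) t\<bar> < inverse (Suc n)"
    by metis
  have "uniform_limit {a..b} (\<lambda>n. poly (p n)) f sequentially"
  proof (rule uniform_limitI)
    fix e :: real assume "e > 0"
    then have "\<forall>\<^sub>F n in sequentially. inverse (real (Suc n)) < e"
      using LIMSEQ_inverse_real_of_nat by (rule order_tendstoD(2)[rotated])
    then show "\<forall>\<^sub>F n in sequentially. \<forall>t\<in>{a..b}. dist (poly (p n) t) (f t) < e"
      by eventually_elim
        (auto simp: dist_real_def abs_minus_commute intro: less_trans[OF p])
  qed
  then show thesis by (rule that)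
qed

lemma fun_calc_selfadjoint:
  fixes X :: "'a::chilbert_space \<Rightarrow>\<^sub>L 'a"
  assumes nontrivial: "\<exists>x::'a. x \<noteq> 0" and X: "positive_op X"
    and f: "continuous_on {0..norm X} f"
  shows "selfadjoint (fun_calc f X)"
proof -
  obtain p where p: "uniform_limit {0..norm X} (\<lambda>n. poly (p n)) f sequentially"
    using uniform_limit_polynomials[OF f] .
  note lim = fun_calc_tendsto[OF nontrivial positive_op_selfadjoint[OF X]
      uniform_limit_on_subset[OF p positive_op_real_spectrum[OF X]]]
  show ?thesis
    unfolding selfadjoint_def
  proof (intro allI)
    fix x y
    have "(\<lambda>n. cinner (blinfun_apply (op_poly (p n) X) x) y)
        \<longlonglongrightarrow> cinner (blinfun_apply (fun_calc f X) x) y"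
      by (intro bounded_bilinear.tendsto[OF bounded_bilinear_cinner] blinfun.tendsto lim
        tendsto_const)
    moreover have "(\<lambda>n. cinner x (blinfun_apply (op_poly (p n) X) y))
        \<longlonglongrightarrow> cinner x (blinfun_apply (fun_calc f X) y)"
      by (intro bounded_bilinear.tendsto[OF bounded_bilinear_cinner] blinfun.tendsto lim
        tendsto_const)
    moreover have "cinner (blinfun_apply (op_poly (p n) X) x) y
        = cinner x (blinfun_apply (op_poly (p n) X) y)" for n
      using selfadjoint_op_poly[OF positive_op_selfadjoint[OF X], of "p n"]
      by (simp add: selfadjoint_def)
    ultimately show "cinner (blinfun_apply (fun_calc f X) x) y
        = cinner x (blinfun_apply (fun_calc f X) y)"
      using LIMSEQ_unique by auto
  qed
qed

text \<open>An approximating polynomial exceeds \<open>c + m t - d\<close> on the spectrum for any \<open>d > 0\<close>, so the lower bound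
  for polynomials passes to the limit.  The case \<open>c = m = 0\<close> is positivity; a supporting line gives
  Jensen's inequality.\<close>

lemma fun_calc_affine_lower_bound:
  fixes X :: "'a::chilbert_space \<Rightarrow>\<^sub>L 'a"
  assumes nontrivial: "\<exists>x::'a. x \<noteq> 0" and X: "positive_op X"
    and f: "continuous_on {0..norm X} f" and lower: "\<And>t. t \<in> {0..norm X} \<Longrightarrow> c + m * t \<le> f t"
  shows "c * (norm x)\<^sup>2 + m * rinner (blinfun_apply X x) x \<le> rinner (blinfun_apply (fun_calc f X) x) x"
proof -
  obtain p where p: "uniform_limit {0..norm X} (\<lambda>n. poly (p n)) f sequentially"
    using uniform_limit_polynomials[OF f] .
  note lim = fun_calc_tendsto[OF nontrivial positive_op_selfadjoint[OF X]
      uniform_limit_on_subset[OF p positive_op_real_spectrum[OF X]]]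
  have lim': "(\<lambda>n. rinner (blinfun_apply (op_poly (p n) X) x) x)
      \<longlonglongrightarrow> rinner (blinfun_apply (fun_calc f X) x) x"
    by (intro tendsto_rinner blinfun.tendsto lim tendsto_const)
  show ?thesis
  proof (rule field_le_epsilon)
    fix e :: real assume "e > 0"
    define d where "d = e / ((norm x)\<^sup>2 + 1)"
    have d: "d > 0" "d * (norm x)\<^sup>2 \<le> e"
      using \<open>e > 0\<close> by (auto simp: d_def divide_simps add_nonneg_pos intro: add_nonneg_pos)
    have "\<forall>\<^sub>F n in sequentially. \<forall>t\<in>{0..norm X}. dist (poly (p n) t) (f t) < d"
      using uniform_limitD[OF p d(1)] .
    then have "\<forall>\<^sub>F n in sequentially. c * (norm x)\<^sup>2 + m * rinner (blinfun_apply X x) x - e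
        \<le> rinner (blinfun_apply (op_poly (p n) X) x) x"
    proof eventually_elim
      case (elim n)
      have "- d * (norm x)\<^sup>2 \<le> rinner (blinfun_apply (op_poly (p n - [:c, m:]) X) x) x"
      proof (rule op_poly_lower_bound[OF nontrivial X])
        fix t assume "t \<in> real_spectrum X"
        then have t: "t \<in> {0..norm X}" using positive_op_real_spectrum[OF X] by blast
        have "dist (poly (p n) t) (f t) < d" using elim t by blast
        then show "- d \<le> poly (p n - [:c, m:]) t"
          using lower[OF t] by (simp add: dist_real_def mult.commute)
      qed
      then show ?case
        using d(2) by (simp add: op_poly_diff op_poly_linear blinfun.diff_left rinner_simps
          rinner_self)
    qed
    then have "c * (norm x)\<^sup>2 + m * rinner (blinfun_apply X x) x - e
        \<le> rinner (blinfun_apply (fun_calc f X) x) x"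
      by (intro tendsto_lowerbound[OF lim']) auto
    then show "c * (norm x)\<^sup>2 + m * rinner (blinfun_apply X x) x
        \<le> rinner (blinfun_apply (fun_calc f X) x) x + e" by simp
  qed
qed

lemma mono_convex_continuous_on:
  fixes f :: "real \<Rightarrow> real"
  assumes mono: "mono_on {0..} f" and convex: "convex_on {0..} f"
  shows "continuous_on {0..} f"
proof -
  have pos: "continuous_on {0<..} f"
    by (intro convex_on_continuous convex_on_subset[OF convex]) auto
  have zero: "(f \<longlongrightarrow> f 0) (at 0 within {0..})"
  proof (rule tendsto_sandwich)
    \<comment> \<open>near \<open>0\<close> the chord over \<open>{0..1}\<close> is an upper bound\<close>
    have "f t \<le> (1 - t) * f 0 + t * f 1" if "0 \<le> t" "t < 1" for t
      using convex_onD[OF convex, of t 0 1] that by simp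
    moreover have "\<forall>\<^sub>F t in at (0::real) within {0..}. t < 1"
      by (rule order_tendstoD(2)[OF tendsto_ident_at]) simp
    moreover have ge: "\<forall>\<^sub>F t in at (0::real) within {0..}. 0 \<le> t"
      by (simp add: eventually_at_filter)
    ultimately show "\<forall>\<^sub>F t in at 0 within {0..}. f t \<le> (1 - t) * f 0 + t * f 1"
      by (auto elim: eventually_elim2)
    show "\<forall>\<^sub>F t in at 0 within {0..}. f 0 \<le> f t"
      using ge by eventually_elim (auto intro: mono_onD[OF mono])
    have "((\<lambda>t. (1 - t) * f 0 + t * f 1) \<longlongrightarrow> (1 - 0) * f 0 + 0 * f 1) (at 0 within {0..})"
      by (intro tendsto_intros)
    then show "((\<lambda>t. (1 - t) * f 0 + t * f 1) \<longlongrightarrow> f 0) (at 0 within {0..})" by simp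
  qed simp
  show ?thesis
    unfolding continuous_on_def
  proof
    fix t :: real assume "t \<in> {0..}"
    then consider "t = 0" | "t > 0" by fastforce
    then show "(f \<longlongrightarrow> f t) (at t within {0..})"
    proof cases
      case 2
      then have "(f \<longlongrightarrow> f t) (at t)"
        using pos by (simp add: continuous_on_eq_continuous_at isCont_def)
      then show ?thesis by (rule tendsto_within_subset) simp
    qed (use zero in simp)
  qed
qed

text \<open>A supporting line of \<open>f\<close> at \<open>\<langle>X x, x\<rangle>\<close> lies below \<open>f\<close> on the spectrum.  The point \<open>0\<close> is not
  interior to the domain, but there the horizontal line supports \<open>f\<close>, which is increasing.\<close>

lemma fun_calc_jensen:
  fixes X :: "'a::chilbert_space \<Rightarrow>\<^sub>L 'a"
  assumes nontrivial: "\<exists>x::'a. x \<noteq> 0" and X: "positive_op X"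
    and mono: "mono_on {0..} f" and convex: "convex_on {0..} f" and x: "norm x = 1"
  shows "f (rinner (blinfun_apply X x) x) \<le> rinner (blinfun_apply (fun_calc f X) x) x"
proof -
  define s where "s = rinner (blinfun_apply X x) x"
  have "s \<ge> 0" using X by (simp add: positive_op_def s_def)
  obtain m where m: "\<And>t. t \<ge> 0 \<Longrightarrow> f s + m * (t - s) \<le> f t"
  proof (cases "s = 0")
    case True
    have "f s + 0 * (t - s) \<le> f t" if "t \<ge> 0" for t
      using mono_onD[OF mono, of 0 t] that True by simp
    then show thesis by (rule that)
  next
    case False
    with \<open>s \<ge> 0\<close> have "s \<in> interior {0..}" by simp
    then show thesis
      using convex_le_Inf_differential[OF convex] that by (metis atLeast_iff)
  qed
  have "(f s - m * s) * (norm x)\<^sup>2 + m * rinner (blinfun_apply X x) x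
      \<le> rinner (blinfun_apply (fun_calc f X) x) x"
  proof (rule fun_calc_affine_lower_bound[OF nontrivial X])
    show "continuous_on {0..norm X} f"
      by (rule continuous_on_subset[OF mono_convex_continuous_on[OF mono convex]]) auto
    show "f s - m * s + m * t \<le> f t" if "t \<in> {0..norm X}" for t
      using m[of t] that by (simp add: algebra_simps)
  qed
  then show ?thesis by (simp add: x s_def)
qed

section \<open>The absolute value and the mixed Schwarz inequality\<close>

lemma fun_calc_ident:
  fixes X :: "'a::chilbert_space \<Rightarrow>\<^sub>L 'a"
  assumes "\<exists>x::'a. x \<noteq> 0" "selfadjoint X"
  shows "fun_calc (\<lambda>t. t) X = X"
proof -
  have "op_poly [:0, 1:] X = X"
    by (rule blinfun_eqI) (simp add: op_poly_linear)
  moreover have "uniform_limit (real_spectrum X) (\<lambda>n::nat. poly [:0, 1:]) (\<lambda>t. t) sequentially"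
    by (simp add: uniform_limit_iff)
  from fun_calc_tendsto[OF assms this] have "op_poly [:0, 1:] X = fun_calc (\<lambda>t. t) X"
    by (simp add: tendsto_const_iff)
  ultimately show ?thesis by simp
qed

context
  fixes A :: "'a::chilbert_space \<Rightarrow>\<^sub>L 'a"
  assumes nontrivial: "\<exists>x::'a. x \<noteq> 0" and A: "A \<in> bounded_operators"
begin

lemma positive_op_op_abs: "positive_op (op_abs A)"
proof -
  note pos = positive_op_adj_compose[OF A]
  have cont: "continuous_on {0..norm (adj A o\<^sub>L A)} sqrt"
    by (intro continuous_intros)
  have "0 \<le> rinner (blinfun_apply (op_abs A) x) x" for x
    using fun_calc_affine_lower_bound[OF nontrivial pos cont, of 0 0 x] by (simp add: op_abs_def)
  then show ?thesis
    using fun_calc_selfadjoint[OF nontrivial pos cont] by (simp add: positive_op_def op_abs_def)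
qed

text \<open>The squares of polynomials that approximate the square root approximate the identity.\<close>

lemma op_abs_square:
  "blinfun_apply (op_abs A) (blinfun_apply (op_abs A) x) = blinfun_apply (adj A) (blinfun_apply A x)"
proof -
  define X where "X = adj A o\<^sub>L A"
  have X: "positive_op X" unfolding X_def by (rule positive_op_adj_compose[OF A])
  note sX = positive_op_selfadjoint[OF X]
  have "continuous_on {0..norm X} sqrt" by (intro continuous_intros)
  then obtain p where p: "uniform_limit {0..norm X} (\<lambda>n. poly (p n)) sqrt sequentially"
    using uniform_limit_polynomials by blast
  note sub = positive_op_real_spectrum[OF X]
  have lim: "(\<lambda>n. op_poly (p n) X) \<longlonglongrightarrow> op_abs A"
    unfolding op_abs_def X_def[symmetric]
    by (rule fun_calc_tendsto[OF nontrivial sX uniform_limit_on_subset[OF p sub]])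
  have bdd: "bounded (sqrt ` {0..norm X})"
    by (intro compact_imp_bounded compact_continuous_image continuous_intros compact_Icc)
  have "uniform_limit {0..norm X} (\<lambda>n t. poly (p n) t * poly (p n) t) (\<lambda>t. sqrt t * sqrt t)
      sequentially"
    by (intro uniform_lim_mult p bdd)
  then have "uniform_limit {0..norm X} (\<lambda>n. poly (p n * p n)) (\<lambda>t. t) sequentially"
    by (rule uniform_limit_cong'[THEN iffD1, rotated -1]) auto
  then have "(\<lambda>n. op_poly (p n * p n) X) \<longlonglongrightarrow> fun_calc (\<lambda>t. t) X"
    by (intro fun_calc_tendsto[OF nontrivial sX] uniform_limit_on_subset[OF _ sub])
  then have "(\<lambda>n. blinfun_apply (op_poly (p n * p n) X) x) \<longlonglongrightarrow> blinfun_apply X x"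
    unfolding fun_calc_ident[OF nontrivial sX] by (intro blinfun.tendsto tendsto_const)
  moreover have "(\<lambda>n. blinfun_apply (op_poly (p n * p n) X) x)
      \<longlonglongrightarrow> blinfun_apply (op_abs A) (blinfun_apply (op_abs A) x)"
    unfolding op_poly_mult by (intro blinfun.tendsto lim tendsto_const)
  ultimately have "blinfun_apply (op_abs A) (blinfun_apply (op_abs A) x) = blinfun_apply X x"
    using LIMSEQ_unique by blast
  then show ?thesis by (simp add: X_def)
qed

text \<open>\<open>A (A\<^sup>* A) = (A A\<^sup>*) A\<close>, hence \<open>A p(A\<^sup>* A) = p(A A\<^sup>*) A\<close>, and one sequence of polynomials serves
  both operators on an interval that contains both spectra.\<close>

lemma op_abs_intertwine:
  "blinfun_apply A (blinfun_apply (op_abs A) x) = blinfun_apply (op_abs (adj A)) (blinfun_apply A x)"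
proof -
  define X where "X = adj A o\<^sub>L A"
  define Y where "Y = A o\<^sub>L adj A"
  note A' = adj_bounded_operators[OF A]
  have X: "positive_op X" unfolding X_def by (rule positive_op_adj_compose[OF A])
  have Y: "positive_op Y"
    unfolding Y_def using positive_op_adj_compose[OF A'] by (simp add: adj_adj[OF A])
  define b where "b = max (norm X) (norm Y)"
  have sub: "real_spectrum X \<subseteq> {0..b}" "real_spectrum Y \<subseteq> {0..b}"
    using positive_op_real_spectrum[OF X] positive_op_real_spectrum[OF Y]
    by (auto simp: b_def subset_iff)
  have "continuous_on {0..b} sqrt" by (intro continuous_intros)
  then obtain p where p: "uniform_limit {0..b} (\<lambda>n. poly (p n)) sqrt sequentially"
    using uniform_limit_polynomials by blast
  have limX: "(\<lambda>n. op_poly (p n) X) \<longlonglongrightarrow> op_abs A"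
    unfolding op_abs_def X_def[symmetric]
    by (rule fun_calc_tendsto[OF nontrivial positive_op_selfadjoint[OF X]
          uniform_limit_on_subset[OF p sub(1)]])
  have limY: "(\<lambda>n. op_poly (p n) Y) \<longlonglongrightarrow> op_abs (adj A)"
    unfolding op_abs_def adj_adj[OF A] Y_def[symmetric]
    by (rule fun_calc_tendsto[OF nontrivial positive_op_selfadjoint[OF Y]
          uniform_limit_on_subset[OF p sub(2)]])
  have "blinfun_apply A (blinfun_apply (op_poly (p n) X) x)
      = blinfun_apply (op_poly (p n) Y) (blinfun_apply A x)" for n
    by (rule op_poly_intertwine) (simp add: X_def Y_def)
  moreover have "(\<lambda>n. blinfun_apply A (blinfun_apply (op_poly (p n) X) x))
      \<longlonglongrightarrow> blinfun_apply A (blinfun_apply (op_abs A) x)"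
    by (intro blinfun.tendsto limX tendsto_const)
  moreover have "(\<lambda>n. blinfun_apply (op_poly (p n) Y) (blinfun_apply A x))
      \<longlonglongrightarrow> blinfun_apply (op_abs (adj A)) (blinfun_apply A x)"
    by (intro blinfun.tendsto limY tendsto_const)
  ultimately show ?thesis
    using LIMSEQ_unique by auto
qed

end

text \<open>A quantitative form of the density of \<open>range A + ker A\<^sup>*\<close>.  Tikhonov regularization replaces
  the orthogonal projection onto the closure of the range: \<open>v = (A A\<^sup>* + \<delta>\<^sup>2)\<inverse> y\<close> gives
  \<open>u = A\<^sup>* v\<close> and \<open>w = \<delta>\<^sup>2 v\<close>.\<close>

lemma range_plus_almost_kernel:
  fixes A :: "'a::chilbert_space \<Rightarrow>\<^sub>L 'a"
  assumes A: "A \<in> bounded_operators" and "\<delta> > 0"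
  obtains u w where "y = blinfun_apply A u + w" "norm w \<le> norm y"
    "norm (blinfun_apply (adj A) w) \<le> \<delta> * norm y"
proof -
  note A' = adj_bounded_operators[OF A]
  have pos: "positive_op (A o\<^sub>L adj A)"
    using positive_op_adj_compose[OF A'] by (simp add: adj_adj[OF A])
  define T where "T = op_poly [:\<delta>\<^sup>2, 1:] (A o\<^sub>L adj A)"
  have T: "T \<in> bounded_operators"
    unfolding T_def
    by (intro selfadjoint_bounded_operators selfadjoint_op_poly positive_op_selfadjoint pos)
  have Tv: "blinfun_apply T v = \<delta>\<^sup>2 *\<^sub>R v + blinfun_apply A (blinfun_apply (adj A) v)" for v
    by (simp add: T_def op_poly_linear)
  have form: "rinner (blinfun_apply T v) v = \<delta>\<^sup>2 * (norm v)\<^sup>2 + (norm (blinfun_apply (adj A) v))\<^sup>2" for v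
    by (simp add: Tv rinner_simps rinner_adj[OF A] rinner_self)
  have "0 < \<delta>\<^sup>2" using \<open>\<delta> > 0\<close> by simp
  moreover have "\<delta>\<^sup>2 * (norm v)\<^sup>2 \<le> rinner (blinfun_apply T v) v" for v
    by (simp add: form)
  ultimately obtain R where "\<And>z. blinfun_apply T (blinfun_apply R z) = z"
    using coercive_invertible[OF T] by metis
  then obtain v where v: "blinfun_apply T v = y" by blast
  have est: "\<delta>\<^sup>2 * (norm v)\<^sup>2 + (norm (blinfun_apply (adj A) v))\<^sup>2 \<le> norm y * norm v"
    using rinner_le_norm[of y v] form[of v] unfolding v by simp
  have w: "\<delta>\<^sup>2 * norm v \<le> norm y"
  proof (cases "v = 0")
    case False
    have "\<delta>\<^sup>2 * norm v * norm v \<le> norm y * norm v"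
      using est zero_le_power2[of "norm (blinfun_apply (adj A) v)"]
      unfolding power2_eq_square[of "norm v"] mult.assoc by linarith
    then show ?thesis using False by simp
  qed simp
  show thesis
  proof (rule that[of "blinfun_apply (adj A) v" "\<delta>\<^sup>2 *\<^sub>R v"])
    show "y = blinfun_apply A (blinfun_apply (adj A) v) + \<delta>\<^sup>2 *\<^sub>R v"
      using v by (simp add: Tv add.commute)
    show "norm (\<delta>\<^sup>2 *\<^sub>R v) \<le> norm y" using w by simp
    show "norm (blinfun_apply (adj A) (\<delta>\<^sup>2 *\<^sub>R v)) \<le> \<delta> * norm y"
    proof (rule power2_le_imp_le)
      have "(norm (blinfun_apply (adj A) (\<delta>\<^sup>2 *\<^sub>R v)))\<^sup>2
          = \<delta>\<^sup>2 * (\<delta>\<^sup>2 * (norm (blinfun_apply (adj A) v))\<^sup>2)"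
        by (simp add: blinfun.scaleR_right power_mult_distrib power2_eq_square)
      also have "\<dots> \<le> \<delta>\<^sup>2 * (\<delta>\<^sup>2 * (norm y * norm v))"
      proof (intro mult_left_mono)
        show "(norm (blinfun_apply (adj A) v))\<^sup>2 \<le> norm y * norm v"
          using est zero_le_power2[of "\<delta> * norm v"] unfolding power_mult_distrib by linarith
      qed auto
      also have "\<dots> = \<delta>\<^sup>2 * (norm y * (\<delta>\<^sup>2 * norm v))" by (simp add: mult_ac)
      also have "\<dots> \<le> \<delta>\<^sup>2 * (norm y * norm y)"
        by (intro mult_left_mono w) auto
      also have "\<dots> = (\<delta> * norm y)\<^sup>2" by (simp add: power2_eq_square mult_ac)
      finally show "(norm (blinfun_apply (adj A) (\<delta>\<^sup>2 *\<^sub>R v)))\<^sup>2 \<le> (\<delta> * norm y)\<^sup>2" .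
    qed (use \<open>\<delta> > 0\<close> in auto)
  qed
qed

text \<open>For \<open>y = A u\<close> this says that the form of \<open>op_abs A\<close> is nonnegative at \<open>x - op_abs A u\<close>.
  An arbitrary \<open>y\<close> differs from such a vector by some \<open>w\<close> with \<open>A\<^sup>* w\<close> small, and
  \<open>op_abs (adj A) w\<close> has the same norm as \<open>A\<^sup>* w\<close>.\<close>

lemma mixed_schwarz:
  fixes A :: "'a::chilbert_space \<Rightarrow>\<^sub>L 'a"
  assumes nontrivial: "\<exists>x::'a. x \<noteq> 0" and A: "A \<in> bounded_operators"
  shows "2 * rinner (blinfun_apply A x) y
    \<le> rinner (blinfun_apply (op_abs A) x) x + rinner (blinfun_apply (op_abs (adj A)) y) y"
proof -
  define P where "P = blinfun_apply (op_abs A)"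
  define Q where "Q = blinfun_apply (op_abs (adj A))"
  have P: "rinner (P a) b = rinner a (P b)" "0 \<le> rinner (P a) a" for a b
    using positive_op_op_abs[OF nontrivial A] selfadjoint_rinner[of "op_abs A"]
    unfolding P_def positive_op_def by auto
  have PP: "P (P a) = blinfun_apply (adj A) (blinfun_apply A a)" for a
    unfolding P_def by (rule op_abs_square[OF nontrivial A])
  have on_range: "2 * rinner (blinfun_apply A x) (blinfun_apply A u)
      \<le> rinner (P x) x + rinner (Q (blinfun_apply A u)) (blinfun_apply A u)" for u
  proof -
    have "rinner (blinfun_apply A x) (blinfun_apply A u) = rinner (P x) (P u)"
      by (simp add: rinner_adj[OF A] PP[symmetric] P(1))
    moreover have "rinner (Q (blinfun_apply A u)) (blinfun_apply A u) = rinner (P (P u)) (P u)"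
      by (simp add: Q_def op_abs_intertwine[OF nontrivial A, symmetric] rinner_adj[OF A]
          PP[symmetric] P_def[symmetric] P(1))
    moreover have "rinner (P (x - P u)) (x - P u)
        = rinner (P x) x - 2 * rinner (P x) (P u) + rinner (P (P u)) (P u)"
    proof -
      have "P (x - P u) = P x - P (P u)" by (simp add: P_def blinfun.diff_right)
      moreover have "rinner (P (P u)) x = rinner (P x) (P u)"
        by (metis P(1) rinner_commute)
      ultimately show ?thesis by (simp add: rinner_simps)
    qed
    ultimately show ?thesis using P(2)[of "x - P u"] by linarith
  qed
  note A' = adj_bounded_operators[OF A]
  have sQ: "selfadjoint (op_abs (adj A))"
    by (intro positive_op_selfadjoint positive_op_op_abs nontrivial A')
  have Q: "rinner (Q a) b = rinner a (Q b)" for a b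
    unfolding Q_def by (rule selfadjoint_rinner[OF sQ])
  have norm_Q: "norm (Q w) = norm (blinfun_apply (adj A) w)" for w
  proof -
    have "(norm (Q w))\<^sup>2 = (norm (blinfun_apply (adj A) w))\<^sup>2"
      unfolding Q_def selfadjoint_norm_square[OF sQ] op_abs_square[OF nontrivial A']
      by (simp add: adj_adj[OF A] rinner_adj[OF A] rinner_self)
    then show ?thesis by (simp add: power2_eq_iff_nonneg)
  qed
  show ?thesis
  proof (rule field_le_epsilon)
    fix e :: real assume "e > 0"
    define C where "C = 2 * norm x * norm y + 3 * norm y * norm y"
    have "C \<ge> 0" by (simp add: C_def)
    define \<delta> where "\<delta> = e / (C + 1)"
    have \<delta>: "\<delta> > 0" "\<delta> * C \<le> e"
      using \<open>e > 0\<close> \<open>C \<ge> 0\<close> by (auto simp: \<delta>_def field_simps)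
    obtain u w where y: "y = blinfun_apply A u + w" and w: "norm w \<le> norm y"
      and Aw: "norm (blinfun_apply (adj A) w) \<le> \<delta> * norm y"
      using range_plus_almost_kernel[OF A \<delta>(1)] .
    have "rinner (blinfun_apply A x) w \<le> norm x * (\<delta> * norm y)"
      unfolding rinner_adj[OF A]
      by (rule order_trans[OF rinner_le_norm]) (intro mult_left_mono Aw norm_ge_zero)
    moreover have "rinner (Q w) w \<le> \<delta> * norm y * norm y"
      by (rule order_trans[OF rinner_le_norm])
        (use w Aw \<delta>(1) in \<open>auto simp: norm_Q intro!: mult_mono\<close>)
    moreover have "- rinner (Q w) y \<le> \<delta> * norm y * norm y"
      using abs_rinner_le_norm[of "Q w" y] mult_right_mono[OF Aw, of "norm y"]
      by (simp add: norm_Q)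
    moreover have "rinner (Q (blinfun_apply A u)) (blinfun_apply A u)
        = rinner (Q y) y - 2 * rinner (Q w) y + rinner (Q w) w"
    proof -
      have "blinfun_apply A u = y - w" by (simp add: y)
      moreover have "Q (y - w) = Q y - Q w" by (simp add: Q_def blinfun.diff_right)
      moreover have "rinner (Q y) w = rinner (Q w) y"
        by (metis Q rinner_commute)
      ultimately show ?thesis by (simp add: rinner_simps)
    qed
    moreover have "rinner (blinfun_apply A x) y
        = rinner (blinfun_apply A x) (blinfun_apply A u) + rinner (blinfun_apply A x) w"
      by (subst y) (rule rinner_add_right)
    ultimately have "2 * rinner (blinfun_apply A x) y \<le> rinner (P x) x + rinner (Q y) y + \<delta> * C"
      using on_range[of u] by (simp add: C_def algebra_simps)
    then show "2 * rinner (blinfun_apply A x) y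
        \<le> rinner (blinfun_apply (op_abs A) x) x + rinner (blinfun_apply (op_abs (adj A)) y) y + e"
      using \<delta>(2) by (simp add: P_def Q_def)
  qed
qed


section \<open>The numerical radius inequality\<close>

theorem theorem2p3:
  fixes A :: "'a::chilbert_space \<Rightarrow>\<^sub>L 'a" and f :: "real \<Rightarrow> real"
  assumes "\<exists>x::'a. x \<noteq> 0"
    and "A \<in> bounded_operators"
    and "f \<in> {0..} \<rightarrow> {0..}"
    and "mono_on {0..} f"
    and "convex_on {0..} f"
  shows "f (numerical_radius A) \<le>
    1 / 2 * norm
      (fun_calc f ((1 / 4) *\<^sub>R (3 *\<^sub>R op_abs A + op_abs (adj A))) +
       fun_calc f ((1 / 4) *\<^sub>R (op_abs A + 3 *\<^sub>R op_abs (adj A))))"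
proof -
  note nontrivial = assms(1) and A = assms(2) and mono = assms(4) and convex = assms(5)
  define P where "P = op_abs A"
  define Q where "Q = op_abs (adj A)"
  define B where "B = (1 / 4) *\<^sub>R (3 *\<^sub>R P + Q)"
  define C where "C = (1 / 4) *\<^sub>R (P + 3 *\<^sub>R Q)"
  define K where "K = 1 / 2 * norm (fun_calc f B + fun_calc f C)"
  have P: "positive_op P"
    unfolding P_def by (rule positive_op_op_abs[OF nontrivial A])
  have Q: "positive_op Q"
    unfolding Q_def by (rule positive_op_op_abs[OF nontrivial adj_bounded_operators[OF A]])
  have B: "positive_op B" and C: "positive_op C"
    unfolding B_def C_def by (intro positive_op_scaleR positive_op_add P Q; simp)+
  define W where "W = (\<lambda>x. cmod (cinner (blinfun_apply A x) x)) ` {x. norm x = 1}"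
  have bound: "f (cmod (cinner (blinfun_apply A x) x)) \<le> K" if x: "norm x = 1" for x
  proof -
    define b where "b = rinner (blinfun_apply B x) x"
    define c where "c = rinner (blinfun_apply C x) x"
    have bc: "b \<ge> 0" "c \<ge> 0"
      using B C by (simp_all add: positive_op_def b_def c_def)
    \<comment> \<open>multiplying \<open>x\<close> by \<open>s\<close> rotates the left side of the mixed Schwarz inequality onto the
        positive axis and leaves the forms on the right side unchanged\<close>
    obtain s where s: "cmod s = 1"
      "cmod (cinner (blinfun_apply A x) x) = rinner (s *\<^sub>C blinfun_apply A x) x"
      by (rule cmod_cinner_eq_rinner)
    have "rinner (blinfun_apply P (s *\<^sub>C x)) (s *\<^sub>C x) = rinner (blinfun_apply P x) x"
    proof -
      have "s * cnj s = 1"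
        using s(1) by (simp add: complex_norm_square[symmetric])
      moreover have "cinner (blinfun_apply P (s *\<^sub>C x)) (s *\<^sub>C x)
          = (s * cnj s) * cinner (blinfun_apply P x) x"
        by (simp add: bounded_operators_scaleC selfadjoint_bounded_operators
          positive_op_selfadjoint P cinner_scaleC_left cinner_scaleC_right)
      ultimately show ?thesis by (simp add: rinner_def)
    qed
    then have "2 * cmod (cinner (blinfun_apply A x) x)
        \<le> rinner (blinfun_apply P x) x + rinner (blinfun_apply Q x) x"
      using mixed_schwarz[OF nontrivial A, of "s *\<^sub>C x" x]
      by (simp add: s(2) bounded_operators_scaleC[OF A] P_def Q_def)
    also have "\<dots> = b + c"
      by (simp add: b_def c_def B_def C_def blinfun.scaleR_left blinfun.add_left rinner_simps
        field_simps)
    finally have "f (cmod (cinner (blinfun_apply A x) x)) \<le> f (1 / 2 * b + 1 / 2 * c)"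
      using bc by (intro mono_onD[OF mono]) auto
    also have "\<dots> \<le> 1 / 2 * f b + 1 / 2 * f c"
      using convex_onD[OF convex, of "1 / 2" b c] bc by simp
    also have "\<dots> \<le> 1 / 2 * rinner (blinfun_apply (fun_calc f B) x) x
        + 1 / 2 * rinner (blinfun_apply (fun_calc f C) x) x"
      unfolding b_def c_def
      by (intro add_mono mult_left_mono fun_calc_jensen[OF nontrivial _ mono convex x] B C) auto
    also have "\<dots> = 1 / 2 * rinner (blinfun_apply (fun_calc f B + fun_calc f C) x) x"
      by (simp add: blinfun.add_left rinner_simps algebra_simps)
    also have "\<dots> \<le> K"
      using order_trans[OF rinner_le_norm[of _ x] mult_right_mono[OF norm_blinfun[of _ x]]] x
      unfolding K_def by fastforce
    finally show ?thesis .
  qed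
  \<comment> \<open>since \<open>f\<close> is continuous, the bound passes to the supremum, which may not be attained\<close>
  have "closed {t \<in> {0..}. f t \<in> {..K}}"
    using continuous_closed_preimage[OF mono_convex_continuous_on[OF mono convex] closed_atLeast
        closed_atMost[of K]] by (simp add: vimage_def Int_def conj_commute)
  then have "closure W \<subseteq> {t \<in> {0..}. f t \<in> {..K}}"
    by (rule closure_minimal[rotated]) (auto simp: W_def bound)
  moreover have "numerical_radius A \<in> closure W"
  proof -
    obtain z :: 'a where "z \<noteq> 0" using nontrivial by blast
    then have "norm (sgn z) = 1" by (simp add: norm_sgn)
    then have "W \<noteq> {}" unfolding W_def by blast
    moreover have "bdd_above W"
    proof (rule bdd_aboveI)
      fix t assume "t \<in> W"
      then obtain x where x: "norm x = 1" and t: "t = cmod (cinner (blinfun_apply A x) x)"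
        unfolding W_def by blast
      show "t \<le> norm A"
        using cmod_cinner_le_norm[of "blinfun_apply A x" x] norm_blinfun[of A x] by (simp add: x t)
    qed
    ultimately show ?thesis
      unfolding numerical_radius_def W_def[symmetric] by (rule closure_contains_Sup)
  qed
  ultimately show ?thesis
    by (auto simp: K_def B_def C_def P_def Q_def)
qed

end
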